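(* Let $\Omega_x,\Omega_y\subset\mathbb{R}$ be bounded domains, $\Omega=\Omega_x\times\Omega_y$, $f\in L^2(\Omega)$, and $g\in H^1_0(\Omega)$ the solution of $-\Delta g=f$ in $\Omega$, $g=0$ on $\partial\Omega$. Let $f_0=f$ and let $(r_n,s_n)_{n\ge1}\subset H^1_0(\Omega_x)\times H^1_0(\Omega_y)$ and $(f_n)_{n\ge1}$ be sequences such that $f_n=f_{n-1}+\Delta(r_n\otimes s_n)$ and, for every $n\ge1$ and all $(r,s)\in H^1_0(\Omega_x)\times H^1_0(\Omega_y)$, $$\int_\Omega\nabla(r_n\otimes s_n)\cdot\nabla(r_n\otimes s+r\otimes s_n)=\int_\Omega f_{n-1}(r_n\otimes s+r\otimes s_n).$$ Let $E_n=\frac12\int_\Omega|\nabla(r_n\otimes s_n)|^2-\int_\Omega f_{n-1}\,r_n\otimes s_n$. Then $$\sum_{n\ge1}\int_\Omega|\nabla(r_n\otimes s_n)|^2=-2\sum_{n\ge1}E_n<\infty.$$ If in addition, for every $n\ge1$, $(r_n,s_n)$ minimizes $(r,s)\mapsto\frac12\int_\Omega|\nabla(r\otimes s)|^2-\int_\Omega f_{n-1}\,r\otimes s$ over $H^1_0(\Omega_x)\times H^1_0(\Omega_y)$ (i.e. the sequence is produced by the Pure Greedy Algorithm), then $g_n:=g-\sum_{k=1}^n r_k\otimes s_k\to0$ in $H^1_0(\Omega)$.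
   Context: Notation: $(r\otimes s)(x,y)=r(x)s(y)$. For $h\in H^{-1}(\Omega)$ and $u\in H^1_0(\Omega)$, $\int_\Omega h\,u$ denotes the duality pairing. *)

theory Defs
  imports "HOL-Analysis.Analysis"
begin

definition L2 :: "'a::euclidean_space set \<Rightarrow> ('a \<Rightarrow> real) set" where
  "L2 U = {u. u \<in> borel_measurable (lebesgue_on U) \<and>
               integrable (lebesgue_on U) (\<lambda>x. (u x)\<^sup>2)}"

definition L2vec :: "'a::euclidean_space set \<Rightarrow> ('a \<Rightarrow> 'a) set" where
  "L2vec U = {G. G \<in> borel_measurable (lebesgue_on U) \<and>
               integrable (lebesgue_on U) (\<lambda>x. (norm (G x))\<^sup>2)}"

text \<open>C-infinity functions on the whole space: every iterated partial derivative exists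
  everywhere and is continuous (largest family closed under taking partial derivatives).\<close>
definition smooth_fun :: "('a::euclidean_space \<Rightarrow> real) \<Rightarrow> bool" where
  "smooth_fun \<phi> \<longleftrightarrow> (\<exists>D. \<phi> \<in> D \<and>
     (\<forall>h\<in>D. continuous_on UNIV h \<and> (\<forall>x. h differentiable (at x)) \<and>
              (\<forall>i\<in>Basis. (\<lambda>x. frechet_derivative h (at x) i) \<in> D)))"

definition test_fun :: "'a::euclidean_space set \<Rightarrow> ('a \<Rightarrow> real) \<Rightarrow> bool" where
  "test_fun U \<phi> \<longleftrightarrow> smooth_fun \<phi> \<and> compact (closure {x. \<phi> x \<noteq> 0}) \<and>
                      closure {x. \<phi> x \<noteq> 0} \<subseteq> U"

definition cgrad :: "('a::euclidean_space \<Rightarrow> real) \<Rightarrow> 'a \<Rightarrow> 'a" where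
  "cgrad \<phi> x = (\<Sum>i\<in>Basis. frechet_derivative \<phi> (at x) i *\<^sub>R i)"

text \<open>H^1_0(U) = closure of C_c^infinity(U) in the H^1 norm; G is the (weak) gradient of u.\<close>
definition is_H10_grad :: "'a::euclidean_space set \<Rightarrow> ('a \<Rightarrow> real) \<Rightarrow> ('a \<Rightarrow> 'a) \<Rightarrow> bool" where
  "is_H10_grad U u G \<longleftrightarrow> u \<in> L2 U \<and> G \<in> L2vec U \<and>
     (\<exists>\<phi>::nat \<Rightarrow> 'a \<Rightarrow> real. (\<forall>k. test_fun U (\<phi> k)) \<and>
        (\<lambda>k. integral\<^sup>L (lebesgue_on U) (\<lambda>x. (\<phi> k x - u x)\<^sup>2)) \<longlonglongrightarrow> 0 \<and>
        (\<lambda>k. integral\<^sup>L (lebesgue_on U) (\<lambda>x. (norm (cgrad (\<phi> k) x - G x))\<^sup>2)) \<longlonglongrightarrow> 0)"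

definition H10 :: "'a::euclidean_space set \<Rightarrow> ('a \<Rightarrow> real) set" where
  "H10 U = {u. \<exists>G. is_H10_grad U u G}"

definition H10_grad :: "'a::euclidean_space set \<Rightarrow> ('a \<Rightarrow> real) \<Rightarrow> 'a \<Rightarrow> 'a" where
  "H10_grad U u = (SOME G. is_H10_grad U u G)"

definition dirichlet :: "'a::euclidean_space set \<Rightarrow> ('a \<Rightarrow> real) \<Rightarrow> ('a \<Rightarrow> real) \<Rightarrow> real" where
  "dirichlet U u v = integral\<^sup>L (lebesgue_on U) (\<lambda>x. H10_grad U u x \<bullet> H10_grad U v x)"

definition tensor :: "(real \<Rightarrow> real) \<Rightarrow> (real \<Rightarrow> real) \<Rightarrow> real \<times> real \<Rightarrow> real" where
  "tensor r s = (\<lambda>(x, y). r x * s y)"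

definition bounded_domain :: "'a::euclidean_space set \<Rightarrow> bool" where
  "bounded_domain U \<longleftrightarrow> U \<noteq> {} \<and> open U \<and> connected U \<and> bounded U"

end

theory Submission
  imports Defs
begin

text \<open>
  Write \<open>t\<^sub>n = r\<^sub>n \<otimes> s\<^sub>n\<close> and \<open>\<langle>u, v\<rangle>\<close> for the Dirichlet form. Then \<open>f\<^sub>n\<close> is represented by
  \<open>g\<^sub>n\<close>, and the Galerkin equation tested with \<open>(r\<^sub>n, s\<^sub>n)\<close> says \<open>\<langle>g\<^sub>n\<^sub>-\<^sub>1, t\<^sub>n\<rangle> = \<langle>t\<^sub>n, t\<^sub>n\<rangle>\<close>. Hence
  \<open>E\<^sub>n = - \<langle>t\<^sub>n, t\<^sub>n\<rangle> / 2\<close> and the energy of \<open>g\<^sub>n\<close> drops by \<open>\<langle>t\<^sub>n, t\<^sub>n\<rangle>\<close> in each step, which gives the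
  first part.

  If the steps are minimizing, then \<open>\<bar>\<langle>g\<^sub>n, v\<rangle>\<bar> \<le> a\<^sub>n \<parallel>v\<parallel>\<close> for all tensor products \<open>v\<close>, where
  \<open>a\<^sub>n = \<parallel>t\<^sub>n\<^sub>+\<^sub>1\<parallel>\<close> is square summable. In \<open>\<parallel>g\<^sub>n\<parallel>\<^sup>2 = \<langle>g\<^sub>n, g\<rangle> - (\<Sum>k=1..n. \<langle>g\<^sub>n, t\<^sub>k\<rangle>)\<close> the sum is therefore at most
  \<open>a\<^sub>n (\<Sum>k<n. a\<^sub>k)\<close>, which is small along a subsequence (otherwise \<open>a\<^sub>n\<^sup>2 \<ge> c / n\<close>), and the first
  term is small because \<open>g\<close> can be approximated by finite sums of tensor products. Since
  \<open>\<parallel>g\<^sub>n\<parallel>\<close> decreases, this suffices; no completeness of \<open>H\<^sup>1\<^sub>0\<close> is needed.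
\<close>

subsection \<open>Square integrable functions\<close>

text \<open>The gradient behind \<open>dirichlet\<close> is picked by \<open>SOME\<close>, so the
  form first has to be shown independent of that choice: the limit gradient is unique a.e., which is
  closability of the gradient on test functions.

  Density is the other obstacle. A polynomial uniformly close to a test function says nothing about
  gradients, and approximating the two partial derivatives separately does not produce one function.
  Hence the mixed derivative is approximated: polynomials stay sums of tensor products when
  integrated in each variable, and a function vanishing on one vertical and one horizontal line is
  controlled, together with its gradient, by its mixed derivative.

  In the limit argument the order of choices matters: a tensor sum S near g, good for all n at once;
  then N beyond which the pairing of g_n with S is small; only then an index m >= N supplied by
  square summability.

  A single predicate for scalar and vector values serves both \<open>L2\<close> and
  \<open>L2vec\<close>.\<close>

definition sq_integrable :: "'a measure \<Rightarrow> ('a \<Rightarrow> 'b::euclidean_space) \<Rightarrow> bool" where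
  "sq_integrable M F \<longleftrightarrow> F \<in> borel_measurable M \<and> integrable M (\<lambda>x. (norm (F x))\<^sup>2)"

lemma sq_integrable_measurable [measurable_dest]: "sq_integrable M F \<Longrightarrow> F \<in> borel_measurable M"
  and sq_integrable_integrable: "sq_integrable M F \<Longrightarrow> integrable M (\<lambda>x. (norm (F x))\<^sup>2)"
  by (auto simp: sq_integrable_def)

text \<open>Parallelogram law with one square dropped. It replaces the triangle inequality of the L2
  norm, so that estimates stay in terms of squared norms.\<close>

lemma norm_add_sq_le: "(norm (x + y :: 'b::real_inner))\<^sup>2 \<le> 2 * (norm x)\<^sup>2 + 2 * (norm y)\<^sup>2"
proof -
  have "(norm (x + y))\<^sup>2 + (norm (x - y))\<^sup>2 = 2 * (norm x)\<^sup>2 + 2 * (norm y)\<^sup>2"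
    by (simp add: power2_norm_eq_inner algebra_simps inner_commute)
  then show ?thesis
    by (smt (verit) zero_le_power2)
qed

lemma sq_integrable_add:
  assumes "sq_integrable M F" "sq_integrable M G"
  shows "sq_integrable M (\<lambda>x. F x + G x)"
  unfolding sq_integrable_def
proof
  note [measurable] = assms[THEN sq_integrable_measurable]
  show "(\<lambda>x. F x + G x) \<in> borel_measurable M" by measurable
  show "integrable M (\<lambda>x. (norm (F x + G x))\<^sup>2)"
  proof (rule Bochner_Integration.integrable_bound)
    show "integrable M (\<lambda>x. 2 * (norm (F x))\<^sup>2 + 2 * (norm (G x))\<^sup>2)"
      using assms by (auto simp: sq_integrable_def)
  qed (auto simp: norm_add_sq_le)
qed

lemma sq_integrable_scaleR: "sq_integrable M F \<Longrightarrow> sq_integrable M (\<lambda>x. c *\<^sub>R F x)"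
  by (auto simp: sq_integrable_def power_mult_distrib)

lemma sq_integrable_diff:
  assumes "sq_integrable M F" "sq_integrable M G"
  shows "sq_integrable M (\<lambda>x. F x - G x)"
  using sq_integrable_add[OF assms(1) sq_integrable_scaleR[OF assms(2), of "-1"]] by simp

lemma integrable_inner_sq_integrable:
  assumes "sq_integrable M F" "sq_integrable M G"
  shows "integrable M (\<lambda>x. F x \<bullet> G x)"
proof (rule Bochner_Integration.integrable_bound)
  note [measurable] = assms[THEN sq_integrable_measurable]
  show "integrable M (\<lambda>x. (norm (F x))\<^sup>2 + (norm (G x))\<^sup>2)"
    using assms by (auto simp: sq_integrable_def)
  show "(\<lambda>x. F x \<bullet> G x) \<in> borel_measurable M" by measurable
  have "\<bar>a \<bullet> b\<bar> \<le> (norm a)\<^sup>2 + (norm b)\<^sup>2" for a b :: 'b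
  proof -
    have "\<bar>a \<bullet> b\<bar> \<le> norm a * norm b" by (rule Cauchy_Schwarz_ineq2)
    also have "\<dots> \<le> (norm a)\<^sup>2 + (norm b)\<^sup>2"
      using sum_squares_bound[of "norm a" "norm b"] mult_nonneg_nonneg[OF norm_ge_zero[of a] norm_ge_zero[of b]]
      by linarith
    finally show ?thesis .
  qed
  then show "AE x in M. norm (F x \<bullet> G x) \<le> norm ((norm (F x))\<^sup>2 + (norm (G x))\<^sup>2)"
    by (auto simp: abs_of_nonneg)
qed

text \<open>Evaluate at the minimizer t = - B / C. The degenerate case C = 0 is kept because the
  lemma is applied to functions and tensor products whose energy may vanish.\<close>

lemma quadratic_nonneg_discriminant:
  fixes A B C :: real
  assumes "\<And>t. 0 \<le> A + 2 * t * B + t\<^sup>2 * C" and "0 \<le> C"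
  shows "B\<^sup>2 \<le> A * C"
proof (cases "C = 0")
  case True
  show ?thesis
  proof (cases "B = 0")
    case False
    \<comment> \<open>This t is the solution of A + 2 t B = -1: a nonconstant affine function is not
      bounded below.\<close>
    have "0 \<le> A + 2 * (- (A + 1) / (2 * B)) * B" using assms(1)[of "- (A + 1) / (2 * B)"] True by simp
    also have "\<dots> = -1" using False by (simp add: field_simps)
    finally show ?thesis by simp
  qed (use True in simp)
next
  case False
  then have C: "C > 0" using assms by simp
  have "0 \<le> A + 2 * (- B / C) * B + (- B / C)\<^sup>2 * C" by (rule assms)
  also have "\<dots> = A - B\<^sup>2 / C" using C by (simp add: field_simps power2_eq_square)
  finally show ?thesis using C by (simp add: field_simps)
qed

lemma integral_Cauchy_Schwarz:
  assumes F: "sq_integrable M F" and G: "sq_integrable M G"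
  shows "(\<integral>x. F x \<bullet> G x \<partial>M)\<^sup>2 \<le> (\<integral>x. (norm (F x))\<^sup>2 \<partial>M) * (\<integral>x. (norm (G x))\<^sup>2 \<partial>M)"
proof (rule quadratic_nonneg_discriminant)
  fix t :: real
  have "0 \<le> (\<integral>x. (norm (F x + t *\<^sub>R G x))\<^sup>2 \<partial>M)" by simp
  also have "\<dots> = (\<integral>x. (norm (F x))\<^sup>2 + 2 * t * (F x \<bullet> G x) + t\<^sup>2 * (norm (G x))\<^sup>2 \<partial>M)"
    by (simp only: power2_norm_eq_inner inner_add_left inner_add_right inner_scaleR_left inner_scaleR_right)
      (simp add: inner_commute algebra_simps power2_eq_square)
  also have "\<dots> = (\<integral>x. (norm (F x))\<^sup>2 \<partial>M) + 2 * t * (\<integral>x. F x \<bullet> G x \<partial>M) + t\<^sup>2 * (\<integral>x. (norm (G x))\<^sup>2 \<partial>M)"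
    using F[THEN sq_integrable_integrable] G[THEN sq_integrable_integrable] integrable_inner_sq_integrable[OF F G]
    by simp
  finally show "0 \<le> \<dots>" .
qed simp

lemma L2_tendsto_inner:
  assumes F: "\<And>n. sq_integrable M (F n)" and F0: "sq_integrable M F0" and H: "sq_integrable M H"
    and lim: "(\<lambda>n. \<integral>x. (norm (F n x - F0 x))\<^sup>2 \<partial>M) \<longlonglongrightarrow> 0"
  shows "(\<lambda>n. \<integral>x. F n x \<bullet> H x \<partial>M) \<longlonglongrightarrow> (\<integral>x. F0 x \<bullet> H x \<partial>M)"
proof -
  let ?e = "\<lambda>n. (\<integral>x. F n x \<bullet> H x \<partial>M) - (\<integral>x. F0 x \<bullet> H x \<partial>M)"
  have e: "?e n = (\<integral>x. (F n x - F0 x) \<bullet> H x \<partial>M)" for n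
    using integrable_inner_sq_integrable[OF F H] integrable_inner_sq_integrable[OF F0 H]
    by (simp add: inner_diff_left)
  have "(\<lambda>n. (?e n)\<^sup>2) \<longlonglongrightarrow> 0"
  proof (rule tendsto_sandwich[where f = "\<lambda>_. 0"])
    show "\<forall>\<^sub>F n in sequentially. (?e n)\<^sup>2 \<le> (\<integral>x. (norm (F n x - F0 x))\<^sup>2 \<partial>M) * (\<integral>x. (norm (H x))\<^sup>2 \<partial>M)"
      unfolding e using integral_Cauchy_Schwarz[OF sq_integrable_diff[OF F F0] H] by simp
    show "(\<lambda>n. (\<integral>x. (norm (F n x - F0 x))\<^sup>2 \<partial>M) * (\<integral>x. (norm (H x))\<^sup>2 \<partial>M)) \<longlonglongrightarrow> 0"
      using tendsto_mult_left_zero[OF lim] by simp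
  qed auto
  then have "?e \<longlonglongrightarrow> 0"
    using tendsto_real_sqrt[of "\<lambda>n. (?e n)\<^sup>2" 0 sequentially] by (simp add: tendsto_rabs_zero_iff)
  then show ?thesis by (simp add: LIM_zero_iff)
qed

lemma L2_tendsto_add:
  assumes F: "\<And>n. sq_integrable M (F n)" and F0: "sq_integrable M F0"
    and G: "\<And>n. sq_integrable M (G n)" and G0: "sq_integrable M G0"
    and "(\<lambda>n. \<integral>x. (norm (F n x - F0 x))\<^sup>2 \<partial>M) \<longlonglongrightarrow> 0"
    and "(\<lambda>n. \<integral>x. (norm (G n x - G0 x))\<^sup>2 \<partial>M) \<longlonglongrightarrow> 0"
  shows "(\<lambda>n. \<integral>x. (norm ((F n x + G n x) - (F0 x + G0 x)))\<^sup>2 \<partial>M) \<longlonglongrightarrow> 0"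
proof (rule tendsto_sandwich[where f = "\<lambda>_. 0"])
  show "\<forall>\<^sub>F n in sequentially. (\<integral>x. (norm ((F n x + G n x) - (F0 x + G0 x)))\<^sup>2 \<partial>M)
      \<le> 2 * (\<integral>x. (norm (F n x - F0 x))\<^sup>2 \<partial>M) + 2 * (\<integral>x. (norm (G n x - G0 x))\<^sup>2 \<partial>M)"
  proof (rule always_eventually, rule allI)
    fix n
    note FF = sq_integrable_diff[OF F F0, of n] and GG = sq_integrable_diff[OF G G0, of n]
    have "(\<integral>x. (norm ((F n x + G n x) - (F0 x + G0 x)))\<^sup>2 \<partial>M) =
      (\<integral>x. (norm ((F n x - F0 x) + (G n x - G0 x)))\<^sup>2 \<partial>M)"
      by (simp add: algebra_simps)
    also have "\<dots> \<le> (\<integral>x. 2 * (norm (F n x - F0 x))\<^sup>2 + 2 * (norm (G n x - G0 x))\<^sup>2 \<partial>M)"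
      using sq_integrable_integrable[OF sq_integrable_add[OF FF GG]] FF[THEN sq_integrable_integrable] GG[THEN sq_integrable_integrable]
      by (intro integral_mono) (auto simp: norm_add_sq_le)
    finally show "(\<integral>x. (norm ((F n x + G n x) - (F0 x + G0 x)))\<^sup>2 \<partial>M)
      \<le> 2 * (\<integral>x. (norm (F n x - F0 x))\<^sup>2 \<partial>M) + 2 * (\<integral>x. (norm (G n x - G0 x))\<^sup>2 \<partial>M)"
      using FF[THEN sq_integrable_integrable] GG[THEN sq_integrable_integrable] by simp
  qed
  show "(\<lambda>n. 2 * (\<integral>x. (norm (F n x - F0 x))\<^sup>2 \<partial>M) + 2 * (\<integral>x. (norm (G n x - G0 x))\<^sup>2 \<partial>M)) \<longlonglongrightarrow> 0"
    using tendsto_add[OF tendsto_mult_right_zero[OF assms(5), of 2] tendsto_mult_right_zero[OF assms(6), of 2]] by simp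
qed auto

lemma L2_tendsto_scaleR:
  assumes "(\<lambda>n. \<integral>x. (norm (F n x - F0 x))\<^sup>2 \<partial>M) \<longlonglongrightarrow> 0"
  shows "(\<lambda>n. \<integral>x. (norm (c *\<^sub>R F n x - c *\<^sub>R F0 x))\<^sup>2 \<partial>M) \<longlonglongrightarrow> 0"
proof -
  have "(norm (c *\<^sub>R F n x - c *\<^sub>R F0 x))\<^sup>2 = c\<^sup>2 * (norm (F n x - F0 x))\<^sup>2" for n x
    by (simp add: scaleR_diff_right[symmetric] power_mult_distrib)
  then show ?thesis using tendsto_mult_right_zero[OF assms, of "c\<^sup>2"] by simp
qed

lemma L2_iff_sq_integrable: "u \<in> L2 U \<longleftrightarrow> sq_integrable (lebesgue_on U) u"
  by (simp add: L2_def sq_integrable_def)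

lemma L2vec_iff_sq_integrable: "u \<in> L2vec U \<longleftrightarrow> sq_integrable (lebesgue_on U) u"
  by (simp add: L2vec_def sq_integrable_def)

lemma sq_integrable_real_iff:
  fixes u :: "'a \<Rightarrow> real"
  shows "sq_integrable M u \<longleftrightarrow> u \<in> borel_measurable M \<and> integrable M (\<lambda>x. (u x)\<^sup>2)"
  by (simp add: sq_integrable_def)

subsection \<open>Smooth functions and integration by parts\<close>

abbreviation dir_deriv :: "'a::real_normed_vector \<Rightarrow> ('a \<Rightarrow> real) \<Rightarrow> 'a \<Rightarrow> real" where
  "dir_deriv i h \<equiv> \<lambda>x. frechet_derivative h (at x) i"

text \<open>Coinduction up to known smooth functions: the witness family is \<open>P\<close>
  together with everything already smooth, so an invariant need not describe derivatives that have
  left it. Continuity comes for free from differentiability.\<close>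

lemma smooth_fun_coinduct:
  assumes "P \<phi>"
    and diff: "\<And>h x. P h \<Longrightarrow> h differentiable (at x)"
    and step: "\<And>h i. P h \<Longrightarrow> i \<in> Basis \<Longrightarrow> P (dir_deriv i h) \<or> smooth_fun (dir_deriv i h)"
  shows "smooth_fun \<phi>"
  unfolding smooth_fun_def
proof (intro exI[of _ "{h. P h \<or> smooth_fun h}"] conjI ballI)
  fix h assume h: "h \<in> {h. P h \<or> smooth_fun h}"
  have d: "\<forall>x. h differentiable (at x)"
    using h diff unfolding smooth_fun_def by blast
  then show "\<forall>x. h differentiable (at x)" .
  show "continuous_on UNIV h"
    by (meson UNIV_I continuous_at_imp_continuous_on d differentiable_imp_continuous_within)
  fix i :: 'a assume i: "i \<in> Basis"
  show "dir_deriv i h \<in> {h. P h \<or> smooth_fun h}"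
  proof (cases "P h")
    case False
    then obtain D where "h \<in> D" "\<forall>h\<in>D. continuous_on UNIV h \<and> (\<forall>x. h differentiable (at x)) \<and>
              (\<forall>i\<in>Basis. dir_deriv i h \<in> D)"
      using h unfolding smooth_fun_def by blast
    then have "smooth_fun (dir_deriv i h)"
      unfolding smooth_fun_def using i by blast
    then show ?thesis by simp
  qed (use step[of h i] i in auto)
qed (use assms in auto)

lemma smooth_fun_continuous: "smooth_fun h \<Longrightarrow> continuous_on A h"
  and smooth_fun_differentiable: "smooth_fun h \<Longrightarrow> h differentiable (at x)"
  unfolding smooth_fun_def by (blast intro: continuous_on_subset)+

lemma smooth_fun_dir_deriv: "smooth_fun h \<Longrightarrow> i \<in> Basis \<Longrightarrow> smooth_fun (dir_deriv i h)"
  unfolding smooth_fun_def by blast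

lemma smooth_fun_has_derivative: "smooth_fun h \<Longrightarrow> (h has_derivative frechet_derivative h (at x)) (at x)"
  using smooth_fun_differentiable frechet_derivative_works by blast

lemma dir_derivI: "(h has_derivative h') (at x) \<Longrightarrow> frechet_derivative h (at x) i = h' i"
  using frechet_derivative_at by metis

lemma smooth_fun_const: "smooth_fun (\<lambda>_. c)"
proof (rule smooth_fun_coinduct[where P = "\<lambda>h. \<exists>c. h = (\<lambda>_. c)"])
  fix h :: "'a \<Rightarrow> real" and i :: 'a assume "\<exists>c. h = (\<lambda>_. c)"
  then show "(\<exists>c. dir_deriv i h = (\<lambda>_. c)) \<or> smooth_fun (dir_deriv i h)"
    by (metis has_derivative_const dir_derivI)
qed auto

lemma smooth_fun_add:
  assumes "smooth_fun f" "smooth_fun g"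
  shows "smooth_fun (\<lambda>x. f x + g x)"
proof (rule smooth_fun_coinduct[where P = "\<lambda>h. \<exists>f g. smooth_fun f \<and> smooth_fun g \<and> h = (\<lambda>x. f x + g x)"])
  fix h :: "'a \<Rightarrow> real" and i :: 'a
  assume "\<exists>f g. smooth_fun f \<and> smooth_fun g \<and> h = (\<lambda>x. f x + g x)" and i: "i \<in> Basis"
  then obtain f g where fg: "smooth_fun f" "smooth_fun g" "h = (\<lambda>x. f x + g x)" by blast
  have "dir_deriv i h = (\<lambda>x. dir_deriv i f x + dir_deriv i g x)"
    unfolding fg(3) by (rule ext, rule dir_derivI) (intro has_derivative_add smooth_fun_has_derivative fg)
  then show "(\<exists>f g. smooth_fun f \<and> smooth_fun g \<and> dir_deriv i h = (\<lambda>x. f x + g x)) \<or> smooth_fun (dir_deriv i h)"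
    using smooth_fun_dir_deriv[OF _ i] fg by blast
qed (use assms in \<open>auto intro: differentiable_add smooth_fun_differentiable\<close>)

text \<open>The invariant for smoothness of products. Single products are not closed under
  differentiation because of the Leibniz rule, but finite sums of them are.\<close>

inductive smooth_product_sum :: "('a::euclidean_space \<Rightarrow> real) \<Rightarrow> bool" where
  base: "smooth_fun f \<Longrightarrow> smooth_fun g \<Longrightarrow> smooth_product_sum (\<lambda>x. f x * g x)"
| add: "smooth_product_sum f \<Longrightarrow> smooth_product_sum g \<Longrightarrow> smooth_product_sum (\<lambda>x. f x + g x)"

lemma smooth_product_sum_dir_deriv:
  assumes "smooth_product_sum h" and i: "i \<in> Basis"
  shows "(\<forall>x. h differentiable (at x)) \<and> smooth_product_sum (dir_deriv i h)"
  using assms(1)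
proof induction
  case (base f g)
  have "dir_deriv i (\<lambda>x. f x * g x) = (\<lambda>x. f x * dir_deriv i g x + dir_deriv i f x * g x)"
    by (rule ext, rule dir_derivI) (intro has_derivative_mult smooth_fun_has_derivative base)
  then show ?case
    using base smooth_fun_dir_deriv[OF _ i]
    by (simp add: smooth_product_sum.intros differentiable_mult smooth_fun_differentiable)
next
  case (add f g)
  then have "dir_deriv i (\<lambda>x. f x + g x) = (\<lambda>x. dir_deriv i f x + dir_deriv i g x)"
    by (intro ext dir_derivI has_derivative_add) (auto simp: frechet_derivative_works[symmetric])
  then show ?case using add by (auto intro: smooth_product_sum.intros differentiable_add)
qed

lemma smooth_fun_mult:
  assumes "smooth_fun f" "smooth_fun g"
  shows "smooth_fun (\<lambda>x. f x * g x)"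
proof (rule smooth_fun_coinduct[where P = smooth_product_sum])
  obtain i :: 'a where i: "i \<in> Basis" using nonempty_Basis by blast
  show "h differentiable (at x)" if "smooth_product_sum h" for h :: "'a \<Rightarrow> real" and x
    using smooth_product_sum_dir_deriv[OF that i] by simp
qed (use assms smooth_product_sum_dir_deriv in \<open>auto intro: smooth_product_sum.base\<close>)

lemma smooth_fun_cmult: "smooth_fun f \<Longrightarrow> smooth_fun (\<lambda>x. c * f x)"
  by (rule smooth_fun_mult[OF smooth_fun_const])

section \<open>Test functions and their gradients\<close>

lemma test_funI:
  assumes "smooth_fun \<phi>" "compact K" "K \<subseteq> U" "\<And>x. x \<notin> K \<Longrightarrow> \<phi> x = 0"
  shows "test_fun U \<phi>"
proof -
  have "closure {x. \<phi> x \<noteq> 0} \<subseteq> K"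
    using assms by (intro closure_minimal) (auto simp: compact_imp_closed)
  moreover from this have "compact (closure {x. \<phi> x \<noteq> 0})"
    using assms(2) by (meson closed_closure compact_Int_closed inf.absorb_iff2 compact_eq_bounded_closed bounded_subset)
  ultimately show ?thesis using assms by (auto simp: test_fun_def)
qed

lemma test_funE:
  assumes "test_fun U \<phi>"
  obtains K where "smooth_fun \<phi>" "compact K" "K \<subseteq> U" "\<And>x. x \<notin> K \<Longrightarrow> \<phi> x = 0"
proof (rule that[of "closure {x. \<phi> x \<noteq> 0}"])
  show "\<phi> x = 0" if "x \<notin> closure {x. \<phi> x \<noteq> 0}" for x
    using that closure_subset[THEN subsetD, of x "{x. \<phi> x \<noteq> 0}"] by auto
qed (use assms in \<open>auto simp: test_fun_def\<close>)

lemma dir_deriv_zero_outside: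
  assumes "compact K" "\<And>x. x \<notin> K \<Longrightarrow> \<phi> x = 0" "x \<notin> K"
  shows "dir_deriv i \<phi> x = 0"
proof -
  have "(\<phi> has_derivative (\<lambda>_. 0)) (at x)"
  proof (rule has_derivative_transform_within_open)
    show "((\<lambda>_. 0) has_derivative (\<lambda>_. 0)) (at x)" by simp
    show "open (- K)" using assms(1) by (simp add: compact_imp_closed open_Compl)
  qed (use assms in auto)
  then show ?thesis using dir_derivI by metis
qed

lemma test_fun_add:
  assumes "test_fun U \<phi>" "test_fun U \<psi>"
  shows "test_fun U (\<lambda>x. \<phi> x + \<psi> x)"
proof -
  obtain K where K: "smooth_fun \<phi>" "compact K" "K \<subseteq> U" "\<And>x. x \<notin> K \<Longrightarrow> \<phi> x = 0"
    using assms(1) by (rule test_funE) blast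
  obtain L where L: "smooth_fun \<psi>" "compact L" "L \<subseteq> U" "\<And>x. x \<notin> L \<Longrightarrow> \<psi> x = 0"
    using assms(2) by (rule test_funE) blast
  show ?thesis
    by (rule test_funI[of _ "K \<union> L"]) (use K L in \<open>auto intro: smooth_fun_add\<close>)
qed

lemma test_fun_cmult:
  assumes "test_fun U \<phi>"
  shows "test_fun U (\<lambda>x. c * \<phi> x)"
proof -
  obtain K where "smooth_fun \<phi>" "compact K" "K \<subseteq> U" "\<And>x. x \<notin> K \<Longrightarrow> \<phi> x = 0"
    using assms by (rule test_funE) blast
  then show ?thesis by (intro test_funI[of _ K] smooth_fun_cmult) auto
qed

lemma cgrad_add:
  assumes "smooth_fun f" "smooth_fun g"
  shows "cgrad (\<lambda>x. f x + g x) x = cgrad f x + cgrad g x"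
proof -
  have "dir_deriv i (\<lambda>x. f x + g x) x = dir_deriv i f x + dir_deriv i g x" for i
    by (rule dir_derivI) (intro has_derivative_add smooth_fun_has_derivative assms)
  then show ?thesis by (simp add: cgrad_def scaleR_add_left sum.distrib)
qed

lemma cgrad_cmult:
  assumes "smooth_fun f"
  shows "cgrad (\<lambda>x. c * f x) x = c *\<^sub>R cgrad f x"
proof -
  have "dir_deriv i (\<lambda>x. c * f x) x = c * dir_deriv i f x" for i
    by (rule dir_derivI) (intro has_derivative_mult_right smooth_fun_has_derivative assms)
  then show ?thesis by (simp add: cgrad_def scaleR_sum_right)
qed

lemma continuous_on_cgrad: "smooth_fun f \<Longrightarrow> continuous_on A (cgrad f)"
  unfolding cgrad_def
  by (intro continuous_on_sum continuous_on_scaleR continuous_on_const smooth_fun_continuous smooth_fun_dir_deriv)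

lemma cgrad_inner_cgrad: "cgrad \<phi> x \<bullet> cgrad \<psi> x = (\<Sum>i\<in>Basis. dir_deriv i \<phi> x * dir_deriv i \<psi> x)"
  by (subst euclidean_inner) (simp add: cgrad_def)

section \<open>Integrals of compactly supported functions\<close>

lemma integrable_lborel_compact_support:
  fixes h :: "'a::euclidean_space \<Rightarrow> 'b::euclidean_space"
  assumes "continuous_on UNIV h" "compact K" "\<And>x. x \<notin> K \<Longrightarrow> h x = 0"
  shows "integrable lborel h"
proof -
  have "integrable lborel (\<lambda>x. indicator K x *\<^sub>R h x)"
    using assms by (intro borel_integrable_compact) (auto intro: continuous_on_subset)
  moreover have "(\<lambda>x. indicator K x *\<^sub>R h x) = h"
    using assms(3) by (force simp: indicator_def)
  ultimately show ?thesis by simp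
qed

lemma sq_integrable_compact_support:
  fixes h :: "'a::euclidean_space \<Rightarrow> 'b::euclidean_space"
  assumes U: "U \<in> sets lebesgue" and h: "continuous_on UNIV h" "compact K" "\<And>x. x \<notin> K \<Longrightarrow> h x = 0"
  shows "sq_integrable (lebesgue_on U) h"
  unfolding sq_integrable_def
proof
  have hm [measurable]: "h \<in> borel_measurable borel" using h(1) by (rule borel_measurable_continuous_onI)
  then show "h \<in> borel_measurable (lebesgue_on U)"
    by (intro measurable_restrict_space1 measurable_completion) simp
  have "integrable lborel (\<lambda>x. (norm (h x))\<^sup>2)"
    by (rule integrable_lborel_compact_support[OF _ h(2)])
      (use h in \<open>auto intro!: continuous_on_power continuous_on_norm\<close>)
  then have "integrable lebesgue (\<lambda>x. (norm (h x))\<^sup>2)"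
    by (subst integrable_completion) auto
  then have "integrable lebesgue (\<lambda>x. indicator U x *\<^sub>R (norm (h x))\<^sup>2)"
    using U by (intro integrable_mult_indicator) auto
  then show "integrable (lebesgue_on U) (\<lambda>x. (norm (h x))\<^sup>2)"
    using U by (subst integrable_restrict_space) auto
qed

text \<open>Second derivatives are included because integration by parts pairs an L2 limit with
  them.\<close>

lemma test_fun_sq_integrable:
  assumes "open U" "test_fun U \<phi>"
  shows "sq_integrable (lebesgue_on U) \<phi>" "sq_integrable (lebesgue_on U) (cgrad \<phi>)"
    and "i \<in> Basis \<Longrightarrow> sq_integrable (lebesgue_on U) (dir_deriv i (dir_deriv i \<phi>))"
proof -
  obtain K where K: "smooth_fun \<phi>" "compact K" "K \<subseteq> U" "\<And>x. x \<notin> K \<Longrightarrow> \<phi> x = 0"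
    using assms(2) by (rule test_funE) blast
  have z: "dir_deriv i \<phi> x = 0" if "x \<notin> K" for i x
    by (rule dir_deriv_zero_outside[OF K(2,4) that])
  have U: "U \<in> sets lebesgue" using assms(1) by simp
  show "sq_integrable (lebesgue_on U) \<phi>"
    by (rule sq_integrable_compact_support[OF U smooth_fun_continuous K(2,4)]) (use K in auto)
  show "sq_integrable (lebesgue_on U) (cgrad \<phi>)"
    by (rule sq_integrable_compact_support[OF U continuous_on_cgrad K(2)]) (use K z in \<open>auto simp: cgrad_def\<close>)
  show "sq_integrable (lebesgue_on U) (dir_deriv i (dir_deriv i \<phi>))" if i: "i \<in> Basis"
    by (rule sq_integrable_compact_support[OF U smooth_fun_continuous K(2)],
        intro smooth_fun_dir_deriv K i, rule dir_deriv_zero_outside[OF K(2)]) (use z in auto)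
qed

text \<open>Integration by parts will rest on translation invariance, which belongs to the whole
  space; functions vanishing off \<open>U\<close> transfer the result.\<close>

lemma integral_lebesgue_on_eq_lborel:
  fixes h :: "'a::euclidean_space \<Rightarrow> real"
  assumes "U \<in> sets lebesgue" "h \<in> borel_measurable borel" "\<And>x. x \<notin> U \<Longrightarrow> h x = 0"
  shows "integral\<^sup>L (lebesgue_on U) h = integral\<^sup>L lborel h"
proof -
  have "integral\<^sup>L (lebesgue_on U) h = integral\<^sup>L lebesgue (\<lambda>x. indicator U x *\<^sub>R h x)"
    using assms(1) by (subst integral_restrict_space) auto
  also have "(\<lambda>x. indicator U x *\<^sub>R h x) = h" using assms(3) by (force simp: indicator_def)
  also have "integral\<^sup>L lebesgue h = integral\<^sup>L lborel h"
    using assms(2) by (intro integral_completion) auto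
  finally show ?thesis .
qed

text \<open>The integral of the difference quotients of \<open>h\<close> vanishes by translation invariance.\<close>

lemma integral_dir_deriv_eq_0:
  fixes h :: "'a::euclidean_space \<Rightarrow> real"
  assumes diff: "\<And>x. h differentiable (at x)" and cont: "continuous_on UNIV (dir_deriv i h)"
    and K: "compact K" "\<And>x. x \<notin> K \<Longrightarrow> h x = 0"
  shows "integral\<^sup>L lborel (dir_deriv i h) = 0"
proof -
  let ?q = "\<lambda>n x. real (Suc n) * (h (inverse (real (Suc n)) *\<^sub>R i + x) - h x)"
  have hc: "continuous_on UNIV h"
    by (meson UNIV_I continuous_at_imp_continuous_on diff differentiable_imp_continuous_within)
  have [measurable]: "h \<in> borel_measurable borel" "dir_deriv i h \<in> borel_measurable borel"
    using hc cont by (auto intro: borel_measurable_continuous_onI)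
  have hint: "integrable lborel h" by (rule integrable_lborel_compact_support[OF hc K])
  have z: "dir_deriv i h x = 0" if "x \<notin> K" for x
    by (rule dir_deriv_zero_outside[OF K that])
  obtain R where R: "K \<subseteq> cball 0 R" "R > 0" using K(1) 
    by (metis bounded_subset_ballD ball_subset_cball compact_imp_bounded order_trans)
  have "bounded (dir_deriv i h ` K)"
    using cont K(1) by (meson compact_continuous_image compact_imp_bounded continuous_on_subset subset_UNIV)
  then obtain B where B: "B > 0" "\<forall>y\<in>dir_deriv i h ` K. norm y \<le> B" by (auto simp: bounded_pos)
  have lineder: "((\<lambda>t. h (t *\<^sub>R i + x)) has_real_derivative dir_deriv i h (t *\<^sub>R i + x)) (at t)" for t x
  proof -
    let ?D = "frechet_derivative h (at (t *\<^sub>R i + x))"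
    have 1: "(h has_derivative ?D) (at (t *\<^sub>R i + x))"
      using diff frechet_derivative_works by blast
    have "((\<lambda>t. t *\<^sub>R i + x) has_derivative (\<lambda>t. t *\<^sub>R i)) (at t)"
      by (auto intro!: derivative_eq_intros)
    from has_derivative_compose[OF this 1]
    have "((\<lambda>t. h (t *\<^sub>R i + x)) has_derivative (\<lambda>s. ?D (s *\<^sub>R i))) (at t)" .
    moreover have "?D (s *\<^sub>R i) = ?D i * s" for s
      using linear_frechet_derivative[OF diff, of "t *\<^sub>R i + x"] by (simp add: linear_scale)
    ultimately show ?thesis by (simp add: has_field_derivative_def)
  qed
  have "(\<lambda>n. integral\<^sup>L lborel (?q n)) \<longlonglongrightarrow> integral\<^sup>L lborel (dir_deriv i h)"
  proof (rule integral_dominated_convergence)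
    \<comment> \<open>The dominating function: by the mean value theorem the quotient at x is the
      derivative at some \<open>\<xi> *\<^sub>R i + x\<close> with \<xi> < 1, which is at most
      \<open>B\<close> and vanishes unless that point lies in \<open>K\<close>, hence unless |x| is
      at most R + |i|.\<close>
    have "integrable lborel (\<lambda>x::'a. indicator (cball 0 (R + norm i)) x *\<^sub>R B)"
      by (rule borel_integrable_compact) auto
    then show "integrable lborel (\<lambda>x::'a. B * indicator (cball 0 (R + norm i)) x)"
      by (simp add: mult.commute)
    show "AE x in lborel. norm (?q n x) \<le> B * indicator (cball 0 (R + norm i)) x" for n
    proof (rule AE_I2)
      fix x
      let ?d = "inverse (real (Suc n))"
      have d: "0 < ?d" "?d \<le> 1" by (auto simp: inverse_le_1_iff)
      obtain \<xi> where \<xi>: "0 < \<xi>" "\<xi> < ?d" "h (?d *\<^sub>R i + x) - h (0 *\<^sub>R i + x) = (?d - 0) * dir_deriv i h (\<xi> *\<^sub>R i + x)"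
        using MVT2[OF d(1), of "\<lambda>t. h (t *\<^sub>R i + x)" "\<lambda>t. dir_deriv i h (t *\<^sub>R i + x)"] lineder by blast
      then have q: "?q n x = dir_deriv i h (\<xi> *\<^sub>R i + x)" by (simp add: field_simps del: of_nat_Suc)
      show "norm (?q n x) \<le> B * indicator (cball 0 (R + norm i)) x"
      proof (cases "\<xi> *\<^sub>R i + x \<in> K")
        case True
        have "norm x \<le> norm (\<xi> *\<^sub>R i + x) + norm (\<xi> *\<^sub>R i)"
          using norm_triangle_ineq4[of "\<xi> *\<^sub>R i + x" "\<xi> *\<^sub>R i"] by simp
        also have "\<dots> \<le> R + norm i"
          using True R(1) \<xi>(1,2) d(2) by (intro add_mono) (auto simp: mult_left_le_one_le)
        finally show ?thesis unfolding q using B True by (auto simp: indicator_def)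
      next
        case False
        then show ?thesis unfolding q using z B by simp
      qed
    qed
    show "AE x in lborel. (\<lambda>n. ?q n x) \<longlonglongrightarrow> dir_deriv i h x"
    proof (rule AE_I2)
      fix x
      have "((\<lambda>t. (h (t *\<^sub>R i + x) - h (0 *\<^sub>R i + x)) / (t - 0)) \<longlongrightarrow> dir_deriv i h (0 *\<^sub>R i + x)) (at 0)"
        using lineder[of x 0] unfolding has_field_derivative_iff by simp
      moreover have "filterlim (\<lambda>n. inverse (real (Suc n))) (at 0) sequentially"
        unfolding filterlim_at using LIMSEQ_inverse_real_of_nat by (auto simp del: of_nat_Suc)
      ultimately have "(\<lambda>n. (h (inverse (real (Suc n)) *\<^sub>R i + x) - h (0 *\<^sub>R i + x)) / (inverse (real (Suc n)) - 0)) \<longlonglongrightarrow> dir_deriv i h (0 *\<^sub>R i + x)"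
        by (rule filterlim_compose)
      then show "(\<lambda>n. ?q n x) \<longlonglongrightarrow> dir_deriv i h x"
        by (simp add: field_simps del: of_nat_Suc)
    qed
  qed measurable
  moreover have "integral\<^sup>L lborel (?q n) = 0" for n
  proof -
    let ?c = "inverse (real (Suc n)) *\<^sub>R i"
    have t: "integral\<^sup>L lborel (\<lambda>x. h (?c + x)) = integral\<^sup>L lborel h"
      using integral_distr[of "(+) ?c" lborel borel h] by (simp add: lborel_distr_plus)
    have "integrable (distr lborel borel ((+) ?c)) h" using hint by (simp add: lborel_distr_plus)
    then have "integrable lborel (\<lambda>x. h (?c + x))"
      by (subst (asm) integrable_distr_eq) auto
    then show ?thesis using t hint by simp
  qed
  ultimately show ?thesis by (simp add: LIMSEQ_const_iff)
qed

text \<open>The integral of the i-th derivative of the product of \<phi> and the i-th derivative of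
  \<psi> vanishes. Since \<phi> appears undifferentiated on the right, L2 convergence in \<phi>
  suffices to pass to the limit there.\<close>

lemma integral_cgrad_inner_cgrad:
  assumes "open U" "test_fun U \<phi>" "test_fun U \<psi>"
  shows "(\<integral>x. cgrad \<phi> x \<bullet> cgrad \<psi> x \<partial>lebesgue_on U)
       = - (\<Sum>i\<in>Basis. \<integral>x. \<phi> x \<bullet> dir_deriv i (dir_deriv i \<psi>) x \<partial>lebesgue_on U)"
proof -
  obtain K where K: "smooth_fun \<phi>" "compact K" "K \<subseteq> U" "\<And>x. x \<notin> K \<Longrightarrow> \<phi> x = 0"
    using assms(2) by (rule test_funE) blast
  have \<psi>: "smooth_fun \<psi>" using assms(3) by (auto simp: test_fun_def)
  have U: "U \<in> sets lebesgue" using assms(1) by simp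
  have z: "dir_deriv i \<phi> x = 0" if "x \<notin> K" for i x
    by (rule dir_deriv_zero_outside[OF K(2,4) that])
  have 1: "integrable lborel (\<lambda>x. dir_deriv i \<phi> x * dir_deriv i \<psi> x)" if "i \<in> Basis" for i
    by (rule integrable_lborel_compact_support[OF smooth_fun_continuous K(2)],
        intro smooth_fun_mult smooth_fun_dir_deriv K(1) \<psi> that) (simp add: z)
  have 2: "integrable lborel (\<lambda>x. \<phi> x * dir_deriv i (dir_deriv i \<psi>) x)" if "i \<in> Basis" for i
    by (rule integrable_lborel_compact_support[OF smooth_fun_continuous K(2)],
        intro smooth_fun_mult smooth_fun_dir_deriv K(1) \<psi> that) (simp add: K(4))
  have ibp: "(\<integral>x. dir_deriv i \<phi> x * dir_deriv i \<psi> x \<partial>lborel) = - (\<integral>x. \<phi> x * dir_deriv i (dir_deriv i \<psi>) x \<partial>lborel)"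
    if i: "i \<in> Basis" for i
  proof -
    let ?h = "\<lambda>x. \<phi> x * dir_deriv i \<psi> x"
    have h: "smooth_fun ?h" by (intro smooth_fun_mult smooth_fun_dir_deriv K(1) \<psi> i)
    have dh: "dir_deriv i ?h = (\<lambda>x. \<phi> x * dir_deriv i (dir_deriv i \<psi>) x + dir_deriv i \<phi> x * dir_deriv i \<psi> x)"
      by (rule ext, rule dir_derivI) (intro has_derivative_mult smooth_fun_has_derivative smooth_fun_dir_deriv K(1) \<psi> i)
    have "integral\<^sup>L lborel (dir_deriv i ?h) = 0"
      by (rule integral_dir_deriv_eq_0[OF smooth_fun_differentiable smooth_fun_continuous K(2)])
        (use h smooth_fun_dir_deriv[OF h i] K(4) in auto)
    then show ?thesis unfolding dh using 1[OF i] 2[OF i] by simp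
  qed
  have "(\<integral>x. cgrad \<phi> x \<bullet> cgrad \<psi> x \<partial>lebesgue_on U) = (\<integral>x. cgrad \<phi> x \<bullet> cgrad \<psi> x \<partial>lborel)"
  proof (rule integral_lebesgue_on_eq_lborel[OF U])
    show "(\<lambda>x. cgrad \<phi> x \<bullet> cgrad \<psi> x) \<in> borel_measurable borel"
      by (intro borel_measurable_continuous_onI continuous_on_inner continuous_on_cgrad K \<psi>)
    show "cgrad \<phi> x \<bullet> cgrad \<psi> x = 0" if "x \<notin> U" for x
    proof -
      have "x \<notin> K" using that K(3) by blast
      then show ?thesis by (simp add: cgrad_def z)
    qed
  qed
  also have "\<dots> = (\<Sum>i\<in>Basis. \<integral>x. dir_deriv i \<phi> x * dir_deriv i \<psi> x \<partial>lborel)"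
    unfolding cgrad_inner_cgrad using 1 by (intro Bochner_Integration.integral_sum) auto
  also have "\<dots> = - (\<Sum>i\<in>Basis. \<integral>x. \<phi> x * dir_deriv i (dir_deriv i \<psi>) x \<partial>lborel)"
    using ibp by (simp add: sum_negf)
  also have "(\<Sum>i\<in>Basis. \<integral>x. \<phi> x * dir_deriv i (dir_deriv i \<psi>) x \<partial>lborel)
    = (\<Sum>i\<in>Basis. \<integral>x. \<phi> x * dir_deriv i (dir_deriv i \<psi>) x \<partial>lebesgue_on U)"
  proof (rule sum.cong[OF refl], rule integral_lebesgue_on_eq_lborel[OF U, symmetric])
    fix i :: 'a assume i: "i \<in> Basis"
    show "(\<lambda>x. \<phi> x * dir_deriv i (dir_deriv i \<psi>) x) \<in> borel_measurable borel"
      by (intro borel_measurable_continuous_onI smooth_fun_continuous smooth_fun_mult smooth_fun_dir_deriv K(1) \<psi> i)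
  qed (use K in auto)
  finally show ?thesis by simp
qed

subsection \<open>The Dirichlet form\<close>

lemma is_H10_grad_iff:
  "is_H10_grad U u G \<longleftrightarrow> sq_integrable (lebesgue_on U) u \<and> sq_integrable (lebesgue_on U) G \<and>
     (\<exists>\<phi>. (\<forall>k. test_fun U (\<phi> k)) \<and>
        (\<lambda>k. \<integral>x. (norm (\<phi> k x - u x))\<^sup>2 \<partial>lebesgue_on U) \<longlonglongrightarrow> 0 \<and>
        (\<lambda>k. \<integral>x. (norm (cgrad (\<phi> k) x - G x))\<^sup>2 \<partial>lebesgue_on U) \<longlonglongrightarrow> 0)"
  by (simp add: is_H10_grad_def L2_iff_sq_integrable L2vec_iff_sq_integrable)

lemma test_fun_smooth: "test_fun U \<phi> \<Longrightarrow> smooth_fun \<phi>"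
  by (simp add: test_fun_def)

lemma is_H10_grad_test_fun:
  assumes "open U" "test_fun U \<phi>"
  shows "is_H10_grad U \<phi> (cgrad \<phi>)"
  unfolding is_H10_grad_iff using assms test_fun_sq_integrable[OF assms]
  by (intro conjI exI[of _ "\<lambda>_. \<phi>"]) auto

lemma is_H10_grad_add:
  assumes U: "open U" and u: "is_H10_grad U u G" and v: "is_H10_grad U v H"
  shows "is_H10_grad U (\<lambda>x. u x + v x) (\<lambda>x. G x + H x)"
proof -
  let ?M = "lebesgue_on U"
  obtain \<phi> where \<phi>: "\<And>k. test_fun U (\<phi> k)" "(\<lambda>k. \<integral>x. (norm (\<phi> k x - u x))\<^sup>2 \<partial>?M) \<longlonglongrightarrow> 0"
        "(\<lambda>k. \<integral>x. (norm (cgrad (\<phi> k) x - G x))\<^sup>2 \<partial>?M) \<longlonglongrightarrow> 0"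
      and su: "sq_integrable ?M u" "sq_integrable ?M G"
    using u unfolding is_H10_grad_iff by blast
  obtain \<psi> where \<psi>: "\<And>k. test_fun U (\<psi> k)" "(\<lambda>k. \<integral>x. (norm (\<psi> k x - v x))\<^sup>2 \<partial>?M) \<longlonglongrightarrow> 0"
        "(\<lambda>k. \<integral>x. (norm (cgrad (\<psi> k) x - H x))\<^sup>2 \<partial>?M) \<longlonglongrightarrow> 0"
      and sv: "sq_integrable ?M v" "sq_integrable ?M H"
    using v unfolding is_H10_grad_iff by blast
  have cg: "cgrad (\<lambda>x. \<phi> k x + \<psi> k x) x = cgrad (\<phi> k) x + cgrad (\<psi> k) x" for k x
    using \<phi>(1) \<psi>(1) by (intro cgrad_add test_fun_smooth)
  note t\<phi> = test_fun_sq_integrable[OF U \<phi>(1)] and t\<psi> = test_fun_sq_integrable[OF U \<psi>(1)]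
  show ?thesis
    unfolding is_H10_grad_iff
  proof (intro conjI exI[of _ "\<lambda>k x. \<phi> k x + \<psi> k x"] allI)
    show "(\<lambda>k. \<integral>x. (norm (\<phi> k x + \<psi> k x - (u x + v x)))\<^sup>2 \<partial>?M) \<longlonglongrightarrow> 0"
      by (rule L2_tendsto_add[OF t\<phi>(1) su(1) t\<psi>(1) sv(1) \<phi>(2) \<psi>(2)])
    show "(\<lambda>k. \<integral>x. (norm (cgrad (\<lambda>x. \<phi> k x + \<psi> k x) x - (G x + H x)))\<^sup>2 \<partial>?M) \<longlonglongrightarrow> 0"
      unfolding cg by (rule L2_tendsto_add[OF t\<phi>(2) su(2) t\<psi>(2) sv(2) \<phi>(3) \<psi>(3)])
  qed (use su sv \<phi>(1) \<psi>(1) in \<open>auto intro: sq_integrable_add test_fun_add\<close>)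
qed

lemma is_H10_grad_cmult:
  assumes u: "is_H10_grad U u G"
  shows "is_H10_grad U (\<lambda>x. c * u x) (\<lambda>x. c *\<^sub>R G x)"
proof -
  let ?M = "lebesgue_on U"
  obtain \<phi> where \<phi>: "\<And>k. test_fun U (\<phi> k)" "(\<lambda>k. \<integral>x. (norm (\<phi> k x - u x))\<^sup>2 \<partial>?M) \<longlonglongrightarrow> 0"
        "(\<lambda>k. \<integral>x. (norm (cgrad (\<phi> k) x - G x))\<^sup>2 \<partial>?M) \<longlonglongrightarrow> 0"
      and su: "sq_integrable ?M u" "sq_integrable ?M G"
    using u unfolding is_H10_grad_iff by blast
  have cg: "cgrad (\<lambda>x. c * \<phi> k x) x = c *\<^sub>R cgrad (\<phi> k) x" for k x
    using \<phi>(1) by (intro cgrad_cmult test_fun_smooth)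
  show ?thesis
    unfolding is_H10_grad_iff
  proof (intro conjI exI[of _ "\<lambda>k x. c * \<phi> k x"] allI)
    show "sq_integrable ?M (\<lambda>x. c * u x)" "sq_integrable ?M (\<lambda>x. c *\<^sub>R G x)"
      using sq_integrable_scaleR[OF su(1), of c] sq_integrable_scaleR[OF su(2), of c] by auto
    show "(\<lambda>k. \<integral>x. (norm (c * \<phi> k x - c * u x))\<^sup>2 \<partial>?M) \<longlonglongrightarrow> 0"
      using L2_tendsto_scaleR[OF \<phi>(2), of c] by (simp only: real_scaleR_def)
    show "(\<lambda>k. \<integral>x. (norm (cgrad (\<lambda>x. c * \<phi> k x) x - c *\<^sub>R G x))\<^sup>2 \<partial>?M) \<longlonglongrightarrow> 0"
      unfolding cg by (rule L2_tendsto_scaleR[OF \<phi>(3)])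
  qed (use \<phi>(1) in \<open>auto intro: test_fun_cmult\<close>)
qed

text \<open>If test functions \<open>\<eta>\<^sub>k\<close> tend to 0 in \<open>L\<^sup>2\<close> and their gradients to \<open>W\<close>, then \<open>W\<close> is orthogonal to
  each \<open>\<nabla>\<eta>\<^sub>k\<close>, as \<open>\<langle>\<nabla>\<eta>\<^sub>m, \<nabla>\<eta>\<^sub>k\<rangle> = - \<langle>\<eta>\<^sub>m, \<Delta>\<eta>\<^sub>k\<rangle>\<close> tends to 0 for \<open>m \<rightarrow> \<infinity>\<close>, and hence to itself.\<close>

lemma is_H10_grad_zero_imp:
  assumes U: "open U" and W: "is_H10_grad U (\<lambda>_. 0) W"
  shows "AE x in lebesgue_on U. W x = 0"
proof -
  let ?M = "lebesgue_on U"
  obtain \<eta> where \<eta>: "\<And>k. test_fun U (\<eta> k)" "(\<lambda>k. \<integral>x. (norm (\<eta> k x - 0))\<^sup>2 \<partial>?M) \<longlonglongrightarrow> 0"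
        "(\<lambda>k. \<integral>x. (norm (cgrad (\<eta> k) x - W x))\<^sup>2 \<partial>?M) \<longlonglongrightarrow> 0"
      and sW: "sq_integrable ?M W"
    using W unfolding is_H10_grad_iff by auto
  note t = test_fun_sq_integrable[OF U \<eta>(1)]
  have z: "sq_integrable ?M (\<lambda>_. 0::real)" by (simp add: sq_integrable_def)
  have 0: "(\<integral>x. W x \<bullet> cgrad (\<eta> k) x \<partial>?M) = 0" for k
  proof -
    have "(\<lambda>m. \<integral>x. cgrad (\<eta> m) x \<bullet> cgrad (\<eta> k) x \<partial>?M) \<longlonglongrightarrow> (\<integral>x. W x \<bullet> cgrad (\<eta> k) x \<partial>?M)"
      by (rule L2_tendsto_inner[OF t(2) sW t(2) \<eta>(3)])
    moreover have "(\<lambda>m. - (\<Sum>i\<in>Basis. \<integral>x. \<eta> m x \<bullet> dir_deriv i (dir_deriv i (\<eta> k)) x \<partial>?M))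
      \<longlonglongrightarrow> - (\<Sum>i\<in>(Basis::'a set). \<integral>x. 0 \<bullet> dir_deriv i (dir_deriv i (\<eta> k)) x \<partial>?M)"
      by (intro tendsto_minus tendsto_sum L2_tendsto_inner[OF t(1) z t(3) \<eta>(2)])
    ultimately have "(\<integral>x. W x \<bullet> cgrad (\<eta> k) x \<partial>?M)
      = - (\<Sum>i\<in>(Basis::'a set). \<integral>x. 0 \<bullet> dir_deriv i (dir_deriv i (\<eta> k)) x \<partial>?M)"
      unfolding integral_cgrad_inner_cgrad[OF U \<eta>(1) \<eta>(1)] by (rule LIMSEQ_unique)
    then show ?thesis by simp
  qed
  have "(\<lambda>k. \<integral>x. cgrad (\<eta> k) x \<bullet> W x \<partial>?M) \<longlonglongrightarrow> (\<integral>x. W x \<bullet> W x \<partial>?M)"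
    by (rule L2_tendsto_inner[OF t(2) sW sW \<eta>(3)])
  then have "(\<integral>x. W x \<bullet> W x \<partial>?M) = 0"
    using 0 by (simp only: inner_commute[of "cgrad _ _"] LIMSEQ_const_iff)
  then have "AE x in ?M. W x \<bullet> W x = 0"
    by (subst (asm) integral_nonneg_eq_0_iff_AE) (auto intro: integrable_inner_sq_integrable sW)
  then show ?thesis by simp
qed

lemma is_H10_grad_unique:
  assumes U: "open U" and "is_H10_grad U u G" "is_H10_grad U u H"
  shows "AE x in lebesgue_on U. G x = H x"
proof -
  have "is_H10_grad U (\<lambda>x. u x + (-1) * u x) (\<lambda>x. G x + (-1) *\<^sub>R H x)"
    using assms by (intro is_H10_grad_add is_H10_grad_cmult)
  then have "AE x in lebesgue_on U. G x + (-1) *\<^sub>R H x = 0"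
    by (intro is_H10_grad_zero_imp[OF U]) simp
  then show ?thesis by simp
qed

lemma H10_gradI: "is_H10_grad U u G \<Longrightarrow> u \<in> H10 U"
  by (auto simp: H10_def)

lemma H10_grad_is_H10_grad: "u \<in> H10 U \<Longrightarrow> is_H10_grad U u (H10_grad U u)"
  unfolding H10_def H10_grad_def by (simp add: someI_ex)

lemma is_H10_grad_sq_integrable: "is_H10_grad U u G \<Longrightarrow> sq_integrable (lebesgue_on U) G"
  by (simp add: is_H10_grad_iff)

text \<open>Any two gradients of the same function agree a.e., so the form may be computed from
  whichever gradient is at hand. Bilinearity follows: the sum of the chosen gradients is a gradient
  of the sum, although perhaps not the chosen one.\<close>

lemma dirichlet_eq:
  assumes U: "open U" and u: "is_H10_grad U u G" and v: "is_H10_grad U v H"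
  shows "dirichlet U u v = (\<integral>x. G x \<bullet> H x \<partial>lebesgue_on U)"
proof -
  let ?G = "H10_grad U u" and ?H = "H10_grad U v"
  have gu: "is_H10_grad U u ?G" and gv: "is_H10_grad U v ?H"
    using u v by (auto intro: H10_grad_is_H10_grad H10_gradI)
  have [measurable]: "G \<in> borel_measurable (lebesgue_on U)" "H \<in> borel_measurable (lebesgue_on U)"
    "?G \<in> borel_measurable (lebesgue_on U)" "?H \<in> borel_measurable (lebesgue_on U)"
    by (rule sq_integrable_measurable[OF is_H10_grad_sq_integrable], fact gu gv u v)+
  show ?thesis
    unfolding dirichlet_def
    using is_H10_grad_unique[OF U gu u] is_H10_grad_unique[OF U gv v]
    by (intro integral_cong_AE) auto
qed

lemma H10_add: "open U \<Longrightarrow> u \<in> H10 U \<Longrightarrow> v \<in> H10 U \<Longrightarrow> (\<lambda>x. u x + v x) \<in> H10 U"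
  by (rule H10_gradI, rule is_H10_grad_add) (auto intro: H10_grad_is_H10_grad)

lemma H10_cmult: "u \<in> H10 U \<Longrightarrow> (\<lambda>x. c * u x) \<in> H10 U"
  by (rule H10_gradI, rule is_H10_grad_cmult) (rule H10_grad_is_H10_grad)

lemma H10_diff: "open U \<Longrightarrow> u \<in> H10 U \<Longrightarrow> v \<in> H10 U \<Longrightarrow> (\<lambda>x. u x - v x) \<in> H10 U"
  using H10_add[OF _ _ H10_cmult[of v U "-1"], of u] by simp

lemma H10_zero: "(\<lambda>_. 0) \<in> H10 U"
  by (rule H10_gradI[of _ _ "\<lambda>_. 0"])
    (simp add: is_H10_grad_iff sq_integrable_def cgrad_def dir_derivI[OF has_derivative_const]
      exI[of _ "\<lambda>_ _. 0"] test_funI[OF smooth_fun_const, of "{}"])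

lemma H10_sum: "open U \<Longrightarrow> (\<And>k. k \<in> A \<Longrightarrow> u k \<in> H10 U) \<Longrightarrow> (\<lambda>x. \<Sum>k\<in>A. u k x) \<in> H10 U"
  by (induction A rule: infinite_finite_induct) (auto intro: H10_zero H10_add)

lemma dirichlet_commute: "dirichlet U u v = dirichlet U v u"
  by (simp add: dirichlet_def inner_commute)

lemma dirichlet_self_nonneg: "0 \<le> dirichlet U u u"
  by (simp add: dirichlet_def)

lemma dirichlet_add_left:
  assumes "open U" "u \<in> H10 U" "v \<in> H10 U" "w \<in> H10 U"
  shows "dirichlet U (\<lambda>x. u x + v x) w = dirichlet U u w + dirichlet U v w"
proof -
  note g = assms(2-4)[THEN H10_grad_is_H10_grad]
  have "dirichlet U (\<lambda>x. u x + v x) w = (\<integral>x. (H10_grad U u x + H10_grad U v x) \<bullet> H10_grad U w x \<partial>lebesgue_on U)"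
    using assms g by (intro dirichlet_eq is_H10_grad_add)
  then show ?thesis
    using g[THEN is_H10_grad_sq_integrable]
    by (simp add: inner_add_left integrable_inner_sq_integrable dirichlet_def)
qed

lemma dirichlet_cmult_left:
  assumes "open U" "u \<in> H10 U" "w \<in> H10 U"
  shows "dirichlet U (\<lambda>x. c * u x) w = c * dirichlet U u w"
proof -
  note g = assms(2-3)[THEN H10_grad_is_H10_grad]
  have "dirichlet U (\<lambda>x. c * u x) w = (\<integral>x. (c *\<^sub>R H10_grad U u x) \<bullet> H10_grad U w x \<partial>lebesgue_on U)"
    using assms g by (intro dirichlet_eq is_H10_grad_cmult)
  then show ?thesis by (simp add: dirichlet_def)
qed

lemma dirichlet_diff_left:
  assumes "open U" "u \<in> H10 U" "v \<in> H10 U" "w \<in> H10 U"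
  shows "dirichlet U (\<lambda>x. u x - v x) w = dirichlet U u w - dirichlet U v w"
  using dirichlet_add_left[OF assms(1,2) H10_cmult[OF assms(3), of "-1"] assms(4)]
    dirichlet_cmult_left[OF assms(1,3,4), of "-1"] by simp

lemma dirichlet_Cauchy_Schwarz:
  assumes "u \<in> H10 U" "v \<in> H10 U"
  shows "(dirichlet U u v)\<^sup>2 \<le> dirichlet U u u * dirichlet U v v"
  using integral_Cauchy_Schwarz[OF assms[THEN H10_grad_is_H10_grad, THEN is_H10_grad_sq_integrable]]
  by (simp add: dirichlet_def power2_norm_eq_inner)

subsection \<open>Tensor products\<close>

lemma AE_lborel_fst:
  assumes "AE x in lborel. P x"
  shows "AE z in (lborel :: ('a::euclidean_space \<times> 'b::euclidean_space) measure). P (fst z)"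
proof -
  obtain N where N: "{x. \<not> P x} \<subseteq> N" "N \<in> null_sets lborel"
    using assms by (auto simp: eventually_ae_filter)
  have "N \<times> UNIV \<in> null_sets (lborel \<Otimes>\<^sub>M lborel :: ('a \<times> 'b) measure)"
    using lborel.times_in_null_sets1[OF N(2), of "UNIV :: 'b set"] by simp
  then show ?thesis
    unfolding lborel_prod by (rule AE_I') (use N in auto)
qed

lemma AE_lborel_snd:
  assumes "AE y in lborel. P y"
  shows "AE z in (lborel :: ('a::euclidean_space \<times> 'b::euclidean_space) measure). P (snd z)"
proof -
  obtain N where N: "{x. \<not> P x} \<subseteq> N" "N \<in> null_sets lborel"
    using assms by (auto simp: eventually_ae_filter)
  have "UNIV \<times> N \<in> null_sets (lborel \<Otimes>\<^sub>M lborel :: ('a \<times> 'b) measure)"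
    using lborel.times_in_null_sets2[OF _ N(2), of "UNIV :: 'a set"] by simp
  then show ?thesis
    unfolding lborel_prod by (rule AE_I') (use N in auto)
qed

text \<open>Lebesgue measurable factors need not give a function measurable for the product of the
  Borel algebras, on which Fubini is applied. Passing to Borel representatives repairs this: the
  exceptional sets are contained in strips over null sets, and these are null in the plane.\<close>

lemma tensor_lebesgue_borel_rep:
  assumes "p \<in> borel_measurable lebesgue" "q \<in> borel_measurable lebesgue"
  obtains p' q' where "p' \<in> borel_measurable borel" "q' \<in> borel_measurable borel"
    "AE x in lborel. p x = p' x" "AE y in lborel. q y = q' y"
    "AE z in lborel. tensor p q z = tensor p' q' z"
    "tensor p' q' \<in> borel_measurable borel" "tensor p q \<in> borel_measurable lebesgue"
proof -
  obtain p' where p': "p' \<in> borel_measurable lborel" "AE x in lborel. p x = p' x"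
    using completion_ex_borel_measurable_real[OF assms(1)] by blast
  obtain q' where q': "q' \<in> borel_measurable lborel" "AE x in lborel. q x = q' x"
    using completion_ex_borel_measurable_real[OF assms(2)] by blast
  have [measurable]: "p' \<in> borel_measurable borel" "q' \<in> borel_measurable borel"
    using p' q' by auto
  have ae: "AE z in lborel. tensor p q z = tensor p' q' z"
    using AE_lborel_fst[OF p'(2)] AE_lborel_snd[OF q'(2)]
    by eventually_elim (simp add: tensor_def case_prod_beta)
  have m: "tensor p' q' \<in> borel_measurable borel"
    unfolding tensor_def borel_prod[symmetric] by measurable
  have "tensor p q \<in> borel_measurable lebesgue"
  proof (rule borel_measurable_AE)
    show "tensor p' q' \<in> borel_measurable lebesgue"
      using m by (intro measurable_completion) simp
    show "AE z in lebesgue. tensor p' q' z = tensor p q z"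
      using ae by (intro AE_completion) auto
  qed
  then show ?thesis using that[of p' q'] p' q' ae m by simp
qed

lemma integrable_tensor_lebesgue:
  assumes p: "integrable lebesgue p" and q: "integrable lebesgue q"
  shows "integrable lebesgue (tensor p q)"
    and "integral\<^sup>L lebesgue (tensor p q) = integral\<^sup>L lebesgue p * integral\<^sup>L lebesgue q"
proof -
  note [measurable] = borel_measurable_integrable[OF p] borel_measurable_integrable[OF q]
  obtain p' q' where [measurable]: "p' \<in> borel_measurable borel" "q' \<in> borel_measurable borel"
    and ae: "AE x in lborel. p x = p' x" "AE y in lborel. q y = q' y"
    "AE z in lborel. tensor p q z = tensor p' q' z"
    and [measurable]: "tensor p' q' \<in> borel_measurable borel" "tensor p q \<in> borel_measurable lebesgue"
    by (rule tensor_lebesgue_borel_rep[OF borel_measurable_integrable[OF p] borel_measurable_integrable[OF q]])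
  have [measurable]: "p' \<in> borel_measurable lebesgue" "q' \<in> borel_measurable lebesgue"
    "tensor p' q' \<in> borel_measurable lebesgue"
    by (intro measurable_completion, simp)+
  note ae' = ae[THEN AE_completion]
  have ip: "integrable lborel p'" "integral\<^sup>L lborel p' = integral\<^sup>L lebesgue p"
    using p integrable_cong_AE[OF _ _ ae'(1)] integral_cong_AE[OF _ _ ae'(1)]
    by (auto simp: integrable_completion integral_completion)
  have iq: "integrable lborel q'" "integral\<^sup>L lborel q' = integral\<^sup>L lebesgue q"
    using q integrable_cong_AE[OF _ _ ae'(2)] integral_cong_AE[OF _ _ ae'(2)]
    by (auto simp: integrable_completion integral_completion)
  have 1: "integrable (lborel \<Otimes>\<^sub>M lborel) (tensor p' q')"
  proof (rule lborel_pair.Fubini_integrable)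
    show "tensor p' q' \<in> borel_measurable (lborel \<Otimes>\<^sub>M lborel)" by (simp add: lborel_prod)
    show "integrable lborel (\<lambda>x. LINT y|lborel. norm (tensor p' q' (x, y)))"
      using ip by (auto simp: tensor_def abs_mult)
    show "AE x in lborel. integrable lborel (\<lambda>y. tensor p' q' (x, y))"
      using iq by (simp add: tensor_def)
  qed
  have "integral\<^sup>L (lborel \<Otimes>\<^sub>M lborel) (tensor p' q') = (\<integral>x. \<integral>y. tensor p' q' (x, y) \<partial>lborel \<partial>lborel)"
    using lborel_pair.integral_fst'[OF 1] by simp
  also have "\<dots> = integral\<^sup>L lborel p' * integral\<^sup>L lborel q'"
    by (simp add: tensor_def)
  finally have 2: "integral\<^sup>L lborel (tensor p' q') = integral\<^sup>L lebesgue p * integral\<^sup>L lebesgue q"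
    using ip iq by (simp add: lborel_prod)
  have c: "integrable lebesgue (tensor p q) \<longleftrightarrow> integrable lebesgue (tensor p' q')"
    "integral\<^sup>L lebesgue (tensor p q) = integral\<^sup>L lebesgue (tensor p' q')"
    using ae'(3) by (intro integrable_cong_AE integral_cong_AE; simp)+
  show "integrable lebesgue (tensor p q)"
    using 1 unfolding c by (simp add: integrable_completion lborel_prod)
  show "integral\<^sup>L lebesgue (tensor p q) = integral\<^sup>L lebesgue p * integral\<^sup>L lebesgue q"
    using 2 unfolding c by (simp add: integral_completion)
qed

text \<open>Extension by zero reduces everything to the whole plane, since both squaring and the
  indicator of A x B factor through the two variables.\<close>

lemma sq_integrable_tensor:
  assumes A: "open A" and B: "open B"
    and p: "sq_integrable (lebesgue_on A) p" and q: "sq_integrable (lebesgue_on B) q"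
  shows "sq_integrable (lebesgue_on (A \<times> B)) (tensor p q)"
    and "(\<integral>z. (tensor p q z)\<^sup>2 \<partial>lebesgue_on (A \<times> B))
       = (\<integral>x. (p x)\<^sup>2 \<partial>lebesgue_on A) * (\<integral>y. (q y)\<^sup>2 \<partial>lebesgue_on B)"
proof -
  have AB: "open (A \<times> B)" using A B by (rule open_Times)
  have s: "A \<in> sets lebesgue" "B \<in> sets lebesgue" "A \<times> B \<in> sets lebesgue" using A B AB by auto
  let ?p = "\<lambda>x. indicator A x *\<^sub>R p x" and ?q = "\<lambda>y. indicator B y *\<^sub>R q y"
  let ?p2 = "\<lambda>x. indicator A x *\<^sub>R (p x)\<^sup>2" and ?q2 = "\<lambda>y. indicator B y *\<^sub>R (q y)\<^sup>2"
  have mp: "?p \<in> borel_measurable lebesgue" "?q \<in> borel_measurable lebesgue"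
    using p q s by (auto simp: sq_integrable_def borel_measurable_restrict_space_iff)
  have mp': "tensor ?p ?q \<in> borel_measurable lebesgue"
    by (rule tensor_lebesgue_borel_rep[OF mp])
  have ip: "integrable lebesgue ?p2" "integrable lebesgue ?q2"
    using p q s by (auto simp: sq_integrable_def integrable_restrict_space)
  have t: "tensor ?p ?q = (\<lambda>z. indicator (A \<times> B) z *\<^sub>R tensor p q z)"
    by (auto simp: tensor_def fun_eq_iff indicator_def)
  have t2: "tensor ?p2 ?q2 = (\<lambda>z. indicator (A \<times> B) z *\<^sub>R (tensor p q z)\<^sup>2)"
    by (auto simp: tensor_def fun_eq_iff indicator_def power_mult_distrib)
  have m: "tensor p q \<in> borel_measurable (lebesgue_on (A \<times> B))"
    using mp' s unfolding t by (simp add: borel_measurable_restrict_space_iff)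
  show "sq_integrable (lebesgue_on (A \<times> B)) (tensor p q)"
    unfolding sq_integrable_real_iff
    using m integrable_tensor_lebesgue(1)[OF ip] s unfolding t2 by (simp add: integrable_restrict_space)
  show "(\<integral>z. (tensor p q z)\<^sup>2 \<partial>lebesgue_on (A \<times> B))
       = (\<integral>x. (p x)\<^sup>2 \<partial>lebesgue_on A) * (\<integral>y. (q y)\<^sup>2 \<partial>lebesgue_on B)"
    using integrable_tensor_lebesgue(2)[OF ip] s unfolding t2 by (simp add: integral_restrict_space)
qed

lemma L2_tendsto_bounded_norm:
  fixes F :: "nat \<Rightarrow> 'a \<Rightarrow> 'b::euclidean_space"
  assumes F: "\<And>n. sq_integrable M (F n)" and F0: "sq_integrable M F0"
    and lim: "(\<lambda>n. \<integral>x. (norm (F n x - F0 x))\<^sup>2 \<partial>M) \<longlonglongrightarrow> 0"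
  obtains C where "\<And>n. (\<integral>x. (norm (F n x))\<^sup>2 \<partial>M) \<le> C" "C \<ge> 0"
proof -
  have "Bseq (\<lambda>n. \<integral>x. (norm (F n x - F0 x))\<^sup>2 \<partial>M)"
    using lim convergent_imp_Bseq convergentI by blast
  then obtain K where K: "K > 0" "\<And>n. norm (\<integral>x. (norm (F n x - F0 x))\<^sup>2 \<partial>M) \<le> K"
    unfolding Bseq_def by blast
  let ?C = "2 * K + 2 * (\<integral>x. (norm (F0 x))\<^sup>2 \<partial>M)"
  have "(\<integral>x. (norm (F n x))\<^sup>2 \<partial>M) \<le> ?C" for n
  proof -
    note d = sq_integrable_diff[OF F[of n] F0]
    have "(\<integral>x. (norm (F n x))\<^sup>2 \<partial>M) \<le> (\<integral>x. 2 * (norm (F n x - F0 x))\<^sup>2 + 2 * (norm (F0 x))\<^sup>2 \<partial>M)"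
      using F[of n] F0 d norm_add_sq_le[of "F n x - F0 x" "F0 x" for x]
      by (intro integral_mono) (simp_all add: sq_integrable_integrable)
    also have "\<dots> = 2 * (\<integral>x. (norm (F n x - F0 x))\<^sup>2 \<partial>M) + 2 * (\<integral>x. (norm (F0 x))\<^sup>2 \<partial>M)"
      using F0 d by (simp add: sq_integrable_integrable)
    also have "\<dots> \<le> ?C" using K(2)[of n] by simp
    finally show ?thesis .
  qed
  moreover have "0 \<le> ?C" using K by simp
  ultimately show ?thesis using that by blast
qed

text \<open>Split the difference as (p_n - p0) tensor q_n plus p0 tensor (q_n - q0). The squared L2
  norm of each summand factors; the first one needs the norms of q_n to be bounded.\<close>

lemma L2_tendsto_tensor:
  assumes A: "open A" and B: "open B"
    and p: "\<And>n. sq_integrable (lebesgue_on A) (p n)" "sq_integrable (lebesgue_on A) p0"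
    and q: "\<And>n. sq_integrable (lebesgue_on B) (q n)" "sq_integrable (lebesgue_on B) q0"
    and plim: "(\<lambda>n. \<integral>x. (norm (p n x - p0 x))\<^sup>2 \<partial>lebesgue_on A) \<longlonglongrightarrow> 0"
    and qlim: "(\<lambda>n. \<integral>y. (norm (q n y - q0 y))\<^sup>2 \<partial>lebesgue_on B) \<longlonglongrightarrow> 0"
  shows "(\<lambda>n. \<integral>z. (norm (tensor (p n) (q n) z - tensor p0 q0 z))\<^sup>2 \<partial>lebesgue_on (A \<times> B)) \<longlonglongrightarrow> 0"
proof -
  let ?M = "lebesgue_on (A \<times> B)"
  let ?u = "\<lambda>n. tensor (\<lambda>x. p n x - p0 x) (q n)" and ?v = "\<lambda>n. tensor p0 (\<lambda>y. q n y - q0 y)"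
  note T = sq_integrable_tensor[OF A B]
  obtain C where C: "\<And>n. (\<integral>y. (norm (q n y))\<^sup>2 \<partial>lebesgue_on B) \<le> C" "C \<ge> 0"
    using L2_tendsto_bounded_norm[OF q qlim] by blast
  have su: "sq_integrable ?M (?u n)" and sv: "sq_integrable ?M (?v n)" for n
    using p q by (auto intro!: T sq_integrable_diff)
  have z: "sq_integrable ?M (\<lambda>_. 0::real)" by (simp add: sq_integrable_def)
  have "(\<lambda>n. \<integral>z. (norm (?u n z - 0))\<^sup>2 \<partial>?M) \<longlonglongrightarrow> 0"
  proof (rule tendsto_sandwich[where f = "\<lambda>_. 0"])
    show "\<forall>\<^sub>F n in sequentially. (\<integral>z. (norm (?u n z - 0))\<^sup>2 \<partial>?M) \<le> (\<integral>x. (norm (p n x - p0 x))\<^sup>2 \<partial>lebesgue_on A) * C"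
      using C by (intro always_eventually allI)
        (simp add: T(2)[OF sq_integrable_diff[OF p(1) p(2)] q(1)] mult_left_mono)
    show "(\<lambda>n. (\<integral>x. (norm (p n x - p0 x))\<^sup>2 \<partial>lebesgue_on A) * C) \<longlonglongrightarrow> 0"
      by (rule tendsto_mult_left_zero[OF plim])
  qed auto
  moreover have "(\<lambda>n. \<integral>z. (norm (?v n z - 0))\<^sup>2 \<partial>?M) \<longlonglongrightarrow> 0"
    using tendsto_mult_right_zero[OF qlim, of "\<integral>x. (p0 x)\<^sup>2 \<partial>lebesgue_on A"]
    by (simp add: T(2)[OF p(2) sq_integrable_diff[OF q(1) q(2)]])
  ultimately have "(\<lambda>n. \<integral>z. (norm ((?u n z + ?v n z) - (0 + 0)))\<^sup>2 \<partial>?M) \<longlonglongrightarrow> 0"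
    by (intro L2_tendsto_add su sv z)
  moreover have "?u n z + ?v n z - (0 + 0) = tensor (p n) (q n) z - tensor p0 q0 z" for n z
    by (simp add: tensor_def case_prod_beta algebra_simps)
  ultimately show ?thesis by simp
qed

section \<open>Derivatives and gradients of tensor products\<close>

lemma dir_deriv_real: "(h has_real_derivative d) (at x) \<Longrightarrow> dir_deriv 1 h x = d"
  using dir_derivI[of h "(*) d" x 1] by (simp add: has_field_derivative_def)

lemma smooth_fun_has_real_derivative:
  fixes h :: "real \<Rightarrow> real"
  assumes "smooth_fun h"
  shows "(h has_real_derivative dir_deriv 1 h x) (at x)"
proof -
  have "linear (frechet_derivative h (at x))"
    by (intro linear_frechet_derivative smooth_fun_differentiable assms)
  then have "frechet_derivative h (at x) t = dir_deriv 1 h x * t" for t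
    using linear_scale[of "frechet_derivative h (at x)" t 1] by (simp add: mult.commute)
  then have "frechet_derivative h (at x) = (*) (dir_deriv 1 h x)" by (rule ext)
  then show ?thesis
    using smooth_fun_has_derivative[OF assms, of x] by (simp add: has_field_derivative_def)
qed

lemma has_derivative_tensor:
  assumes "smooth_fun p" "smooth_fun q"
  shows "(tensor p q has_derivative
    (\<lambda>h. fst h * (dir_deriv 1 p (fst z) * q (snd z)) + snd h * (p (fst z) * dir_deriv 1 q (snd z)))) (at z)"
proof -
  have p: "(p has_derivative (\<lambda>h. dir_deriv 1 p (fst z) * h)) (at (fst z))"
    and q: "(q has_derivative (\<lambda>h. dir_deriv 1 q (snd z) * h)) (at (snd z))"
    using assms[THEN smooth_fun_has_real_derivative] by (auto simp: has_field_derivative_def)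
  have "((\<lambda>z. p (fst z) * q (snd z)) has_derivative
     (\<lambda>h. p (fst z) * (dir_deriv 1 q (snd z) * snd h) + dir_deriv 1 p (fst z) * fst h * q (snd z))) (at z)"
    by (intro has_derivative_mult has_derivative_compose[OF has_derivative_fst[OF has_derivative_ident] p]
      has_derivative_compose[OF has_derivative_snd[OF has_derivative_ident] q])
  then show ?thesis by (simp add: tensor_def case_prod_beta' algebra_simps)
qed

lemma dir_deriv_tensor:
  assumes "smooth_fun p" "smooth_fun q"
  shows "dir_deriv (1, 0) (tensor p q) = tensor (dir_deriv 1 p) q"
    and "dir_deriv (0, 1) (tensor p q) = tensor p (dir_deriv 1 q)"
  by (auto simp: fun_eq_iff dir_derivI[OF has_derivative_tensor[OF assms]]) (simp_all add: tensor_def)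

lemma Basis_real_prod: "(Basis :: (real \<times> real) set) = {(1, 0), (0, 1)}"
  by (auto simp: Basis_prod_def)

lemma smooth_fun_tensor:
  assumes "smooth_fun p" "smooth_fun q"
  shows "smooth_fun (tensor p q)"
proof (rule smooth_fun_coinduct[where P = "\<lambda>h. \<exists>p q. smooth_fun p \<and> smooth_fun q \<and> h = tensor p q"])
  fix h :: "real \<times> real \<Rightarrow> real"
  assume "\<exists>p q. smooth_fun p \<and> smooth_fun q \<and> h = tensor p q"
  then obtain p q where h: "smooth_fun p" "smooth_fun q" "h = tensor p q" by blast
  show "h differentiable (at x)" for x
    unfolding h(3) using has_derivative_tensor[OF h(1,2)] by (rule differentiableI)
  fix i :: "real \<times> real" assume i: "i \<in> Basis"
  have "smooth_fun (dir_deriv 1 p)" "smooth_fun (dir_deriv 1 q)"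
    using h by (auto intro: smooth_fun_dir_deriv)
  then show "(\<exists>p q. smooth_fun p \<and> smooth_fun q \<and> dir_deriv i h = tensor p q) \<or> smooth_fun (dir_deriv i h)"
    using i h dir_deriv_tensor[OF h(1,2)] unfolding Basis_real_prod by auto
qed (use assms in auto)

lemma test_fun_tensor:
  assumes "test_fun A p" "test_fun B q"
  shows "test_fun (A \<times> B) (tensor p q)"
proof -
  obtain K where K: "smooth_fun p" "compact K" "K \<subseteq> A" "\<And>x. x \<notin> K \<Longrightarrow> p x = 0"
    using assms(1) by (rule test_funE) blast
  obtain L where L: "smooth_fun q" "compact L" "L \<subseteq> B" "\<And>x. x \<notin> L \<Longrightarrow> q x = 0"
    using assms(2) by (rule test_funE) blast
  show ?thesis
  proof (rule test_funI[of _ "K \<times> L"])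
    show "tensor p q z = 0" if "z \<notin> K \<times> L" for z
      using K(4)[of "fst z"] L(4)[of "snd z"] that by (cases z) (auto simp: tensor_def)
  qed (use K L in \<open>auto intro: smooth_fun_tensor compact_Times\<close>)
qed

lemma cgrad_prod: "cgrad h z = (dir_deriv (1, 0) h z, dir_deriv (0, 1) h z)"
  unfolding cgrad_def Basis_real_prod by simp

lemma cgrad_real: "cgrad h = dir_deriv 1 h"
  by (simp add: cgrad_def fun_eq_iff)

lemma norm_sq_real_prod: "(norm (z :: real \<times> real))\<^sup>2 = (fst z)\<^sup>2 + (snd z)\<^sup>2"
  by (cases z) (simp add: norm_Pair)

lemma sq_integrable_Pair:
  fixes u v :: "'a \<Rightarrow> real"
  assumes "sq_integrable M u" "sq_integrable M v"
  shows "sq_integrable M (\<lambda>x. (u x, v x))"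
  using assms unfolding sq_integrable_def by (auto simp: norm_Pair)

text \<open>Tensor the two approximating sequences. Each component of the resulting gradient is
  again a tensor product, with the derivative on one factor, so L2 convergence is checked
  componentwise.\<close>

lemma is_H10_grad_tensor:
  assumes A: "open A" and B: "open B"
    and r: "is_H10_grad A r G" and s: "is_H10_grad B s H"
  shows "is_H10_grad (A \<times> B) (tensor r s) (\<lambda>z. (tensor G s z, tensor r H z))"
proof -
  let ?M = "lebesgue_on (A \<times> B)"
  obtain \<phi> where \<phi>: "\<And>k. test_fun A (\<phi> k)" "(\<lambda>k. \<integral>x. (norm (\<phi> k x - r x))\<^sup>2 \<partial>lebesgue_on A) \<longlonglongrightarrow> 0"
        "(\<lambda>k. \<integral>x. (norm (cgrad (\<phi> k) x - G x))\<^sup>2 \<partial>lebesgue_on A) \<longlonglongrightarrow> 0"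
      and sr: "sq_integrable (lebesgue_on A) r" "sq_integrable (lebesgue_on A) G"
    using r unfolding is_H10_grad_iff by blast
  obtain \<psi> where \<psi>: "\<And>k. test_fun B (\<psi> k)" "(\<lambda>k. \<integral>x. (norm (\<psi> k x - s x))\<^sup>2 \<partial>lebesgue_on B) \<longlonglongrightarrow> 0"
        "(\<lambda>k. \<integral>x. (norm (cgrad (\<psi> k) x - H x))\<^sup>2 \<partial>lebesgue_on B) \<longlonglongrightarrow> 0"
      and ss: "sq_integrable (lebesgue_on B) s" "sq_integrable (lebesgue_on B) H"
    using s unfolding is_H10_grad_iff by blast
  note t\<phi> = test_fun_sq_integrable[OF A \<phi>(1)] and t\<psi> = test_fun_sq_integrable[OF B \<psi>(1)]
  have cg: "cgrad (tensor (\<phi> k) (\<psi> k)) z = (tensor (cgrad (\<phi> k)) (\<psi> k) z, tensor (\<phi> k) (cgrad (\<psi> k)) z)" for k z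
    using dir_deriv_tensor[OF \<phi>(1)[THEN test_fun_smooth] \<psi>(1)[THEN test_fun_smooth], THEN fun_cong]
    unfolding cgrad_prod cgrad_real by simp
  note T = sq_integrable_tensor(1)[OF A B]
  show ?thesis
    unfolding is_H10_grad_iff
  proof (intro conjI exI[of _ "\<lambda>k. tensor (\<phi> k) (\<psi> k)"] allI)
    show "(\<lambda>k. \<integral>x. (norm (tensor (\<phi> k) (\<psi> k) x - tensor r s x))\<^sup>2 \<partial>?M) \<longlonglongrightarrow> 0"
      by (rule L2_tendsto_tensor[OF A B t\<phi>(1) sr(1) t\<psi>(1) ss(1) \<phi>(2) \<psi>(2)])
    have 1: "(\<lambda>k. \<integral>x. (norm (tensor (cgrad (\<phi> k)) (\<psi> k) x - tensor G s x))\<^sup>2 \<partial>?M) \<longlonglongrightarrow> 0"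
      by (rule L2_tendsto_tensor[OF A B t\<phi>(2) sr(2) t\<psi>(1) ss(1) \<phi>(3) \<psi>(2)])
    have 2: "(\<lambda>k. \<integral>x. (norm (tensor (\<phi> k) (cgrad (\<psi> k)) x - tensor r H x))\<^sup>2 \<partial>?M) \<longlonglongrightarrow> 0"
      by (rule L2_tendsto_tensor[OF A B t\<phi>(1) sr(1) t\<psi>(2) ss(2) \<phi>(2) \<psi>(3)])
    have "(\<integral>x. (norm (cgrad (tensor (\<phi> k) (\<psi> k)) x - (tensor G s x, tensor r H x)))\<^sup>2 \<partial>?M) =
      (\<integral>x. (norm (tensor (cgrad (\<phi> k)) (\<psi> k) x - tensor G s x))\<^sup>2 \<partial>?M)
      + (\<integral>x. (norm (tensor (\<phi> k) (cgrad (\<psi> k)) x - tensor r H x))\<^sup>2 \<partial>?M)" for k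
      unfolding cg norm_sq_real_prod[of "_ - _"]
      using sq_integrable_integrable[OF sq_integrable_diff[OF T[OF t\<phi>(2) t\<psi>(1)] T[OF sr(2) ss(1)]], of k k]
        sq_integrable_integrable[OF sq_integrable_diff[OF T[OF t\<phi>(1) t\<psi>(2)] T[OF sr(1) ss(2)]], of k k]
      by simp
    then show "(\<lambda>k. \<integral>x. (norm (cgrad (tensor (\<phi> k) (\<psi> k)) x - (tensor G s x, tensor r H x)))\<^sup>2 \<partial>?M) \<longlonglongrightarrow> 0"
      using tendsto_add[OF 1 2] by simp
  qed (use \<phi>(1) \<psi>(1) sr ss in \<open>auto intro!: T test_fun_tensor sq_integrable_Pair\<close>)
qed

lemma H10_tensor: "open A \<Longrightarrow> open B \<Longrightarrow> r \<in> H10 A \<Longrightarrow> s \<in> H10 B \<Longrightarrow> tensor r s \<in> H10 (A \<times> B)"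
  by (rule H10_gradI, rule is_H10_grad_tensor) (auto intro: H10_grad_is_H10_grad)

subsection \<open>Smooth cutoffs\<close>

lemma smooth_fun_real_coinduct:
  fixes \<phi> :: "real \<Rightarrow> real"
  assumes "P \<phi>"
    and step: "\<And>h. P h \<Longrightarrow> \<exists>h'. (\<forall>x. (h has_real_derivative h' x) (at x)) \<and> (P h' \<or> smooth_fun h')"
  shows "smooth_fun \<phi>"
proof (rule smooth_fun_coinduct[where P = P])
  fix h :: "real \<Rightarrow> real" assume "P h"
  then obtain h' where h': "\<And>x. (h has_real_derivative h' x) (at x)" "P h' \<or> smooth_fun h'"
    using step by blast
  show "h differentiable (at x)" for x
    using h'(1)[of x] by (meson differentiableI has_field_derivative_def)
  fix i :: real assume i: "i \<in> Basis"
  have "dir_deriv 1 h = h'" using dir_deriv_real[OF h'(1)] by (rule ext)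
  then show "P (dir_deriv i h) \<or> smooth_fun (dir_deriv i h)" using h'(2) i by simp
qed (fact assms)

text \<open>Every differentiation produces a factor \<open>a\<close> by the chain rule; the
  invariant therefore carries a constant that absorbs it.\<close>

lemma smooth_fun_compose_affine:
  fixes h :: "real \<Rightarrow> real"
  assumes "smooth_fun h"
  shows "smooth_fun (\<lambda>x. h (a * x + b))"
proof (rule smooth_fun_real_coinduct[where P = "\<lambda>f. \<exists>c h. smooth_fun h \<and> f = (\<lambda>x. c * h (a * x + b))"])
  show "\<exists>c h'. smooth_fun h' \<and> (\<lambda>x. h (a * x + b)) = (\<lambda>x. c * h' (a * x + b))"
    using assms by (intro exI[of _ 1] exI[of _ h]) simp
  fix f assume "\<exists>c h. smooth_fun h \<and> f = (\<lambda>x. c * h (a * x + b))"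
  then obtain c h where h: "smooth_fun h" "f = (\<lambda>x. c * h (a * x + b))" by blast
  have "(f has_real_derivative (c * a) * dir_deriv 1 h (a * x + b)) (at x)" for x
    unfolding h(2)
    by (rule derivative_eq_intros DERIV_chain2[OF smooth_fun_has_real_derivative[OF h(1)]] refl)+ simp
  then show "\<exists>f'. (\<forall>x. (f has_real_derivative f' x) (at x)) \<and>
      ((\<exists>c h. smooth_fun h \<and> f' = (\<lambda>x. c * h (a * x + b))) \<or> smooth_fun f')"
    using smooth_fun_dir_deriv[OF h(1), of 1]
    by (intro exI[of _ "\<lambda>x. (c * a) * dir_deriv 1 h (a * x + b)"]) auto
qed

text \<open>The invariant allows any power of g in the denominator, because the derivative of f /
  g^n is (f' g - n f g') / g^(n+1).\<close>

lemma smooth_fun_divide: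
  fixes f g :: "real \<Rightarrow> real"
  assumes f: "smooth_fun f" and g: "smooth_fun g" and nz: "\<And>x. g x \<noteq> 0"
  shows "smooth_fun (\<lambda>x. f x / g x)"
proof (rule smooth_fun_real_coinduct[where P = "\<lambda>h. \<exists>f n. smooth_fun f \<and> h = (\<lambda>x. f x / g x ^ n)"])
  show "\<exists>f' n. smooth_fun f' \<and> (\<lambda>x. f x / g x) = (\<lambda>x. f' x / g x ^ n)"
    using f by (intro exI[of _ f] exI[of _ 1]) simp
  fix h assume "\<exists>f n. smooth_fun f \<and> h = (\<lambda>x. f x / g x ^ n)"
  then obtain f n where h: "smooth_fun f" "h = (\<lambda>x. f x / g x ^ n)" by blast
  let ?k = "\<lambda>x. dir_deriv 1 f x * g x + (- real n) * (f x * dir_deriv 1 g x)"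
  have k: "smooth_fun ?k"
    by (intro smooth_fun_add smooth_fun_mult smooth_fun_const h g smooth_fun_dir_deriv) auto
  have "(h has_real_derivative ?k x / g x ^ Suc n) (at x)" for x
  proof -
    have "((\<lambda>x. f x / g x ^ n) has_real_derivative
      (dir_deriv 1 f x * g x ^ n - f x * (real n * (dir_deriv 1 g x * g x ^ (n - 1)))) / (g x ^ n * g x ^ n)) (at x)"
      using nz by (intro DERIV_divide smooth_fun_has_real_derivative h
        DERIV_power[OF smooth_fun_has_real_derivative[OF g], THEN DERIV_cong]) auto
    moreover have "(dir_deriv 1 f x * g x ^ n - f x * (real n * (dir_deriv 1 g x * g x ^ (n - 1)))) / (g x ^ n * g x ^ n) = ?k x / g x ^ Suc n"
      using nz[of x] by (cases n) (simp_all add: field_simps)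
    ultimately show ?thesis unfolding h(2) by simp
  qed
  then show "\<exists>h'. (\<forall>x. (h has_real_derivative h' x) (at x)) \<and>
      ((\<exists>f n. smooth_fun f \<and> h' = (\<lambda>x. f x / g x ^ n)) \<or> smooth_fun h')"
    using k by (intro exI[of _ "\<lambda>x. ?k x / g x ^ Suc n"]) blast
qed

text \<open>For p = 1 this is the classical flat function exp(-1/x), extended by zero. The
  polynomial in 1/x makes the family closed under differentiation: with t = 1/x, p is replaced by
  t^2 (p - p').\<close>

definition exp_inv_poly :: "real poly \<Rightarrow> real \<Rightarrow> real" where
  "exp_inv_poly p x = (if x > 0 then poly p (inverse x) * exp (- inverse x) else 0)"

text \<open>The free power of t is what makes induction over the coefficients work: splitting off
  the constant coefficient raises \<open>k\<close> by one.\<close>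

lemma poly_mult_exp_minus_tendsto_0:
  "((\<lambda>t::real. t ^ k * poly p t * exp (- t)) \<longlongrightarrow> 0) at_top"
proof (induction p arbitrary: k)
  case (pCons a p)
  have "((\<lambda>t::real. a * (t ^ k / exp t) + t ^ Suc k * poly p t * exp (- t)) \<longlongrightarrow> a * 0 + 0) at_top"
    by (intro tendsto_intros tendsto_power_div_exp_0 pCons.IH)
  then show ?case by (simp add: algebra_simps exp_minus divide_inverse)
qed simp

lemma exp_inv_poly_has_derivative:
  "(exp_inv_poly p has_real_derivative exp_inv_poly ([:0, 0, 1:] * (p - pderiv p)) x) (at x)"
proof (cases x "0::real" rule: linorder_cases)
  case less
  have "((\<lambda>_. 0) has_real_derivative 0) (at x)" by simp
  then show ?thesis
    using less by (rule_tac DERIV_cong[OF has_field_derivative_transform_within_open[where S = "{..<0}"]])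
      (auto simp: exp_inv_poly_def)
next
  case greater
  have "((\<lambda>x. poly p (inverse x) * exp (- inverse x)) has_real_derivative
     poly ([:0, 0, 1:] * (p - pderiv p)) (inverse x) * exp (- inverse x)) (at x)"
    using greater
    by (auto intro!: derivative_eq_intros DERIV_chain2[OF poly_DERIV] simp: algebra_simps power2_eq_square)
  then have "(exp_inv_poly p has_real_derivative
     poly ([:0, 0, 1:] * (p - pderiv p)) (inverse x) * exp (- inverse x)) (at x)"
    by (rule has_field_derivative_transform_within_open[where S = "{0<..}"])
      (use greater in \<open>auto simp: exp_inv_poly_def\<close>)
  then show ?thesis using greater by (simp add: exp_inv_poly_def)
next
  case equal
  \<comment> \<open>The additional factor 1/t is the denominator of the difference quotient at
    0.\<close>
  have "((\<lambda>t. inverse t ^ 1 * poly p (inverse t) * exp (- inverse t)) \<longlongrightarrow> 0) (at_right (0::real))"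
    by (rule filterlim_compose[OF poly_mult_exp_minus_tendsto_0 filterlim_inverse_at_top_right])
  then have "((\<lambda>t. (exp_inv_poly p t - exp_inv_poly p 0) / (t - 0)) \<longlongrightarrow> 0) (at_right 0)"
    by (rule Lim_transform_eventually)
      (auto simp: eventually_at_right_field exp_inv_poly_def divide_inverse intro!: exI[of _ 1])
  moreover have "((\<lambda>t. (exp_inv_poly p t - exp_inv_poly p 0) / (t - 0)) \<longlongrightarrow> 0) (at_left 0)"
    by (rule Lim_transform_eventually[OF tendsto_const])
      (auto simp: eventually_at_left_field exp_inv_poly_def intro!: exI[of _ "-1"])
  ultimately have "((\<lambda>t. (exp_inv_poly p t - exp_inv_poly p 0) / (t - 0)) \<longlongrightarrow> 0) (at 0)"
    by (simp add: filterlim_at_split)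
  then show ?thesis using equal by (simp add: has_field_derivative_iff exp_inv_poly_def)
qed

lemma smooth_fun_exp_inv_poly: "smooth_fun (exp_inv_poly p)"
  by (rule smooth_fun_real_coinduct[where P = "\<lambda>h. \<exists>p. h = exp_inv_poly p"])
    (use exp_inv_poly_has_derivative in blast)+

lemma smooth_step_exists:
  obtains K :: "real \<Rightarrow> real" where "smooth_fun K" "\<And>x. x \<le> 0 \<Longrightarrow> K x = 0" "\<And>x. x \<ge> 1 \<Longrightarrow> K x = 1"
proof -
  let ?e = "exp_inv_poly 1"
  \<comment> \<open>The standard smooth step e(x) / (e(x) + e(1 - x)). The denominator is positive
    because x or 1 - x is; 1 - x is written as an affine map.\<close>
  let ?K = "\<lambda>x. ?e x / (?e x + ?e (-1 * x + 1))"
  have nn: "?e x \<ge> 0" for x by (simp add: exp_inv_poly_def)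
  have pos: "?e x + ?e (-1 * x + 1) \<noteq> 0" for x
  proof (cases "x > 0")
    case True
    then have "?e x > 0" by (simp add: exp_inv_poly_def)
    then show ?thesis using nn[of "-1 * x + 1"] by linarith
  next
    case False
    then have "?e (-1 * x + 1) > 0" by (simp add: exp_inv_poly_def)
    then show ?thesis using nn[of x] by linarith
  qed
  have "smooth_fun ?K"
    by (intro smooth_fun_divide smooth_fun_add smooth_fun_compose_affine smooth_fun_exp_inv_poly pos)
  moreover have "?K x = 0" if "x \<le> 0" for x using that by (simp add: exp_inv_poly_def)
  moreover have "?K x = 1" if "x \<ge> 1" for x
  proof -
    have "?e (-1 * x + 1) = 0" using that by (simp add: exp_inv_poly_def)
    then show ?thesis using pos[of x] by simp
  qed
  ultimately show ?thesis using that by blast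
qed

lemma smooth_cutoff_exists:
  fixes \<alpha> \<beta> \<delta> :: real
  assumes "\<delta> > 0"
  obtains \<eta> where "smooth_fun \<eta>" "\<And>x. x \<in> {\<alpha>..\<beta>} \<Longrightarrow> \<eta> x = 1" "\<And>x. x \<notin> {\<alpha> - \<delta>..\<beta> + \<delta>} \<Longrightarrow> \<eta> x = 0"
proof -
  obtain K :: "real \<Rightarrow> real" where K: "smooth_fun K" "\<And>x. x \<le> 0 \<Longrightarrow> K x = 0" "\<And>x. x \<ge> 1 \<Longrightarrow> K x = 1"
    by (rule smooth_step_exists) blast
  \<comment> \<open>The first factor rises from 0 to 1 between \<alpha> - \<delta> and \<alpha>, the
    second falls from 1 to 0 between \<beta> and \<beta> + \<delta>.\<close>
  let ?\<eta> = "\<lambda>x. K ((1 / \<delta>) * x + (1 - \<alpha> / \<delta>)) * K ((- 1 / \<delta>) * x + (1 + \<beta> / \<delta>))"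
  show ?thesis
  proof (rule that[of ?\<eta>])
    show "smooth_fun ?\<eta>" by (intro smooth_fun_mult smooth_fun_compose_affine K)
    show "?\<eta> x = 1" if "x \<in> {\<alpha>..\<beta>}" for x
      using that assms by (subst (1 2) K(3)) (auto simp: field_simps)
    show "?\<eta> x = 0" if "x \<notin> {\<alpha> - \<delta>..\<beta> + \<delta>}" for x
    proof -
      have "(1 / \<delta>) * x + (1 - \<alpha> / \<delta>) \<le> 0 \<or> (- 1 / \<delta>) * x + (1 + \<beta> / \<delta>) \<le> 0"
      proof (cases "x < \<alpha> - \<delta>")
        case False
        then have "\<beta> + \<delta> \<le> x" using that by auto
        then have "(\<beta> + \<delta> - x) / \<delta> \<le> 0" using assms by (simp add: divide_nonpos_pos)
        also have "(\<beta> + \<delta> - x) / \<delta> = (- 1 / \<delta>) * x + (1 + \<beta> / \<delta>)"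
          using assms by (simp add: divide_simps)
        finally show ?thesis by simp
      qed (use assms in \<open>simp add: field_simps\<close>)
      then show ?thesis using K(2) by auto
    qed
  qed
qed

text \<open>Connectedness enters here: the interval spanned by the extreme points of
  \<open>K\<close>, slightly enlarged, stays inside \<open>U\<close>. It leaves room for a
  one-dimensional cutoff.\<close>

lemma compact_subset_open_interval:
  fixes U K :: "real set"
  assumes U: "open U" "connected U" "U \<noteq> {}" and K: "compact K" "K \<subseteq> U"
  obtains \<alpha> \<beta> \<delta> where "\<alpha> \<le> \<beta>" "\<delta> > 0" "K \<subseteq> {\<alpha>..\<beta>}" "{\<alpha> - \<delta>..\<beta> + \<delta>} \<subseteq> U"
proof -
  obtain a where a: "a \<in> U" using U(3) by blast
  \<comment> \<open>The extra point guarantees that minimum and maximum exist even for an empty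
    \<open>K\<close>, the support of the zero function.\<close>
  let ?K = "insert a K"
  have c: "compact ?K" using K by (intro compact_insert)
  obtain \<alpha> where \<alpha>: "\<alpha> \<in> ?K" "\<And>x. x \<in> ?K \<Longrightarrow> \<alpha> \<le> x" using compact_attains_inf[OF c] by auto
  obtain \<beta> where \<beta>: "\<beta> \<in> ?K" "\<And>x. x \<in> ?K \<Longrightarrow> x \<le> \<beta>" using compact_attains_sup[OF c] by auto
  have U': "\<alpha> \<in> U" "\<beta> \<in> U" using \<alpha> \<beta> a K by auto
  obtain d1 where d1: "d1 > 0" "cball \<alpha> d1 \<subseteq> U" using U(1) U'(1) open_contains_cball by blast
  obtain d2 where d2: "d2 > 0" "cball \<beta> d2 \<subseteq> U" using U(1) U'(2) open_contains_cball by blast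
  let ?d = "min d1 d2"
  have "\<alpha> - ?d \<in> cball \<alpha> d1" "\<beta> + ?d \<in> cball \<beta> d2"
    using d1(1) d2(1) by (auto simp: dist_real_def)
  then have "\<alpha> - ?d \<in> U" "\<beta> + ?d \<in> U" using d1 d2 by auto
  then have "{\<alpha> - ?d..\<beta> + ?d} \<subseteq> U" using connected_contains_Icc[OF U(2)] by blast
  moreover have "K \<subseteq> {\<alpha>..\<beta>}" using \<alpha>(2) \<beta>(2) by fastforce
  moreover have "\<alpha> \<le> \<beta>" "?d > 0" using \<alpha>(2)[OF \<beta>(1)] d1 d2 by auto
  ultimately show ?thesis using that by blast
qed

subsection \<open>Density of sums of tensor products\<close>

text \<open>Finite sums without coefficients: in the spaces used, a scalar can be absorbed into one
  of the factors.\<close>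

inductive tensor_span :: "(real \<Rightarrow> real) set \<Rightarrow> (real \<Rightarrow> real) set \<Rightarrow> (real \<times> real \<Rightarrow> real) \<Rightarrow> bool"
  for V W where
  zero: "tensor_span V W (\<lambda>_. 0)"
| add: "tensor_span V W h \<Longrightarrow> p \<in> V \<Longrightarrow> q \<in> W \<Longrightarrow> tensor_span V W (\<lambda>z. h z + tensor p q z)"

lemma tensor_span_single: "p \<in> V \<Longrightarrow> q \<in> W \<Longrightarrow> tensor_span V W (tensor p q)"
  using tensor_span.add[OF tensor_span.zero, of p V q W] by simp

lemma tensor_span_add:
  assumes "tensor_span V W g" "tensor_span V W h"
  shows "tensor_span V W (\<lambda>z. g z + h z)"
  using assms(2)
proof induction
  case zero
  then show ?case using assms(1) by simp
next
  case (add h p q)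
  then show ?case using tensor_span.add[of V W "\<lambda>z. g z + h z" p q] by (simp add: add.assoc)
qed

text \<open>Multiplication acts factor by factor and may change the spaces. This covers products of
  polynomials as well as cutoffs, which turn smooth factors into test functions.\<close>

lemma tensor_span_tensor_mult:
  assumes "tensor_span V W h" "\<And>v. v \<in> V \<Longrightarrow> (\<lambda>x. p x * v x) \<in> V'" "\<And>w. w \<in> W \<Longrightarrow> (\<lambda>x. q x * w x) \<in> W'"
  shows "tensor_span V' W' (\<lambda>z. tensor p q z * h z)"
  using assms(1)
proof induction
  case zero
  then show ?case by (simp add: tensor_span.zero)
next
  case (add h v w)
  have "(\<lambda>z. tensor p q z * (h z + tensor v w z)) = (\<lambda>z. tensor p q z * h z + tensor (\<lambda>x. p x * v x) (\<lambda>x. q x * w x) z)"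
    by (auto simp: tensor_def fun_eq_iff algebra_simps)
  then show ?case using add assms(2,3) by (auto intro: tensor_span.add)
qed

lemma tensor_span_smooth_mult:
  fixes g h :: "real \<times> real \<Rightarrow> real"
  defines "V \<equiv> {p. smooth_fun p}"
  assumes "tensor_span V V g" "tensor_span V V h"
  shows "tensor_span V V (\<lambda>z. g z * h z)"
  using assms(2)
proof induction
  case zero
  then show ?case by (simp add: tensor_span.zero)
next
  case (add g p q)
  have "tensor_span V V (\<lambda>z. tensor p q z * h z)"
    using add assms(3) by (intro tensor_span_tensor_mult[of V V]) (auto simp: V_def intro: smooth_fun_mult)
  then have "tensor_span V V (\<lambda>z. g z * h z + tensor p q z * h z)"
    using add by (intro tensor_span_add)
  then show ?case by (simp add: algebra_simps)
qed

lemma smooth_fun_ident: "smooth_fun (\<lambda>x::real. x)"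
proof (rule smooth_fun_real_coinduct[where P = "\<lambda>h. h = (\<lambda>x. x)"])
  fix h :: "real \<Rightarrow> real" assume "h = (\<lambda>x. x)"
  then show "\<exists>h'. (\<forall>x. (h has_real_derivative h' x) (at x)) \<and> (h' = (\<lambda>x. x) \<or> smooth_fun h')"
    by (intro exI[of _ "\<lambda>_. 1"]) (simp add: smooth_fun_const)
qed simp

text \<open>Makes the output of Stone-Weierstrass usable: a linear function a x + b y is a sum of
  two tensor products, and the span is closed under sums and products.\<close>

lemma real_polynomial_function_tensor_span:
  assumes "real_polynomial_function P"
  shows "tensor_span {p. smooth_fun p} {p. smooth_fun p} (P :: real \<times> real \<Rightarrow> real)"
  using assms
proof induction
  case (linear f)
  then interpret bounded_linear f .
  obtain a b where "a = f (1, 0)" "b = f (0, 1)" by blast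
  then have ab: "f (x, y) = a * x + b * y" for x y
    using add[of "x *\<^sub>R (1, 0)" "y *\<^sub>R (0, 1)"] scale[of x "(1, 0)"] scale[of y "(0, 1)"] by simp
  have "f = (\<lambda>z. tensor (\<lambda>x. a * x) (\<lambda>_. 1) z + tensor (\<lambda>_. b) (\<lambda>y. y) z)"
    by (auto simp: tensor_def fun_eq_iff ab)
  moreover have "tensor_span {p. smooth_fun p} {p. smooth_fun p} \<dots>"
    by (intro tensor_span_add tensor_span_single)
      (auto intro: smooth_fun_ident smooth_fun_const smooth_fun_cmult)
  ultimately show ?case by simp
next
  case (const c)
  have "(\<lambda>_. c) = tensor (\<lambda>_. c) (\<lambda>_. 1)" by (auto simp: tensor_def)
  then show ?case by (simp add: tensor_span_single smooth_fun_const)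
qed (auto intro: tensor_span_add tensor_span_smooth_mult)

section \<open>Mixed antiderivatives and their bounds\<close>

lemma smooth_antiderivative:
  fixes f :: "real \<Rightarrow> real"
  assumes "smooth_fun f"
  obtains F where "smooth_fun F" "F a = 0" "dir_deriv 1 F = f"
proof -
  have "\<exists>F. \<forall>x::real. ereal x > -\<infinity> \<longrightarrow> ereal x < \<infinity> \<longrightarrow> (F has_vector_derivative f x) (at x)"
    using smooth_fun_continuous[OF assms, of UNIV]
    by (intro einterval_antiderivative) (auto simp: continuous_on_eq_continuous_at)
  then obtain F where F: "\<And>x. (F has_real_derivative f x) (at x)"
    by (auto simp: has_real_derivative_iff_has_vector_derivative)
  let ?F = "\<lambda>x. F x - F a"
  have F': "(?F has_real_derivative f x) (at x)" for x
    using F[of x] by (auto intro!: derivative_eq_intros)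
  have "smooth_fun ?F"
    using F' assms by (intro smooth_fun_real_coinduct[where P = "\<lambda>h. h = ?F"]) blast+
  moreover have "dir_deriv 1 ?F = f" using dir_deriv_real[OF F'] by (rule ext)
  ultimately show ?thesis using that[of ?F] by simp
qed

text \<open>Integrate each factor separately, from \<open>a\<close> in the first variable and from
  \<open>c\<close> in the second. This keeps the tensor structure and gives zero values on the two
  lines.\<close>

lemma tensor_span_smooth_antiderivative:
  fixes a c :: real
  defines "V \<equiv> {p. smooth_fun p}"
  assumes "tensor_span V V P"
  shows "\<exists>S. tensor_span V V S \<and> smooth_fun S \<and> (\<forall>y. S (a, y) = 0) \<and> (\<forall>x. S (x, c) = 0)
    \<and> dir_deriv (0, 1) (dir_deriv (1, 0) S) = P"
  using assms(2)
proof induction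
  case zero
  then show ?case
    by (intro exI[of _ "\<lambda>_. 0"]) (simp add: tensor_span.zero smooth_fun_const dir_derivI[OF has_derivative_const])
next
  case (add h p q)
  then obtain S where S: "tensor_span V V S" "smooth_fun S" "\<And>y. S (a, y) = 0" "\<And>x. S (x, c) = 0"
    "dir_deriv (0, 1) (dir_deriv (1, 0) S) = h" by blast
  have "smooth_fun p" "smooth_fun q" using add by (auto simp: V_def)
  obtain P where P: "smooth_fun P" "P a = 0" "dir_deriv 1 P = p"
    using smooth_antiderivative[OF \<open>smooth_fun p\<close>] by blast
  obtain Q where Q: "smooth_fun Q" "Q c = 0" "dir_deriv 1 Q = q"
    using smooth_antiderivative[OF \<open>smooth_fun q\<close>] by blast
  let ?S = "\<lambda>z. S z + tensor P Q z"
  have T: "smooth_fun (tensor P Q)" "smooth_fun (tensor p Q)"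
    using P Q \<open>smooth_fun p\<close> by (auto intro: smooth_fun_tensor)
  have B: "(1, 0) \<in> (Basis :: (real \<times> real) set)" by (simp add: Basis_real_prod)
  note dS = smooth_fun_dir_deriv[OF S(2) B]
  have "dir_deriv (1, 0) ?S = (\<lambda>z. dir_deriv (1, 0) S z + dir_deriv (1, 0) (tensor P Q) z)"
    by (rule ext, rule dir_derivI) (intro has_derivative_add smooth_fun_has_derivative S T)
  then have 1: "dir_deriv (1, 0) ?S = (\<lambda>z. dir_deriv (1, 0) S z + tensor p Q z)"
    by (simp add: dir_deriv_tensor(1)[OF P(1) Q(1), THEN fun_cong] P(3))
  have "dir_deriv (0, 1) (\<lambda>z. dir_deriv (1, 0) S z + tensor p Q z)
     = (\<lambda>z. dir_deriv (0, 1) (dir_deriv (1, 0) S) z + dir_deriv (0, 1) (tensor p Q) z)"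
    by (rule ext, rule dir_derivI) (intro has_derivative_add smooth_fun_has_derivative dS T)
  then have 2: "dir_deriv (0, 1) (dir_deriv (1, 0) ?S) = (\<lambda>z. h z + tensor p q z)"
    unfolding 1 by (simp add: S(5)[THEN fun_cong] dir_deriv_tensor(2)[OF \<open>smooth_fun p\<close> Q(1), THEN fun_cong] Q(3))
  show ?case
  proof (intro exI[of _ ?S] conjI allI)
    show "tensor_span V V ?S" using S(1) P(1) Q(1) by (intro tensor_span.add) (simp_all add: V_def)
    show "smooth_fun ?S" by (intro smooth_fun_add S(2) T(1))
    show "?S (a, y) = 0" for y by (simp add: S(3) tensor_def P(2))
    show "?S (x, c) = 0" for x by (simp add: S(4) tensor_def Q(2))
  qed (fact 2)
qed

lemma has_real_derivative_slice:
  assumes "smooth_fun (h :: real \<times> real \<Rightarrow> real)"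
  shows "((\<lambda>t. h (t, y)) has_real_derivative dir_deriv (1, 0) h (x, y)) (at x)"
    and "((\<lambda>t. h (x, t)) has_real_derivative dir_deriv (0, 1) h (x, y)) (at y)"
proof -
  let ?D = "frechet_derivative h (at (x, y))"
  have h: "(h has_derivative ?D) (at (x, y))" by (rule smooth_fun_has_derivative[OF assms])
  have lin: "linear ?D" by (intro linear_frechet_derivative smooth_fun_differentiable assms)
  have "((\<lambda>t. (t, y)) has_derivative (\<lambda>t. (t, 0))) (at x)"
    by (auto intro!: derivative_eq_intros)
  from has_derivative_compose[OF this h]
  have "((\<lambda>t. h (t, y)) has_derivative (\<lambda>t. ?D (t, 0))) (at x)" .
  moreover have "(\<lambda>t. ?D (t, 0)) = (*) (?D (1, 0))"
  proof
    show "?D (t, 0) = ?D (1, 0) * t" for t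
      using linear_scale[OF lin, of t "(1, 0)"] by simp
  qed
  ultimately show "((\<lambda>t. h (t, y)) has_real_derivative ?D (1, 0)) (at x)"
    unfolding has_field_derivative_def by (simp only:)
  have "((\<lambda>t. (x, t)) has_derivative (\<lambda>t. (0, t))) (at y)"
    by (auto intro!: derivative_eq_intros)
  from has_derivative_compose[OF this h]
  have "((\<lambda>t. h (x, t)) has_derivative (\<lambda>t. ?D (0, t))) (at y)" .
  moreover have "(\<lambda>t. ?D (0, t)) = (*) (?D (0, 1))"
  proof
    show "?D (0, t) = ?D (0, 1) * t" for t
      using linear_scale[OF lin, of t "(0, 1)"] by simp
  qed
  ultimately show "((\<lambda>t. h (x, t)) has_real_derivative ?D (0, 1)) (at y)"
    unfolding has_field_derivative_def by (simp only:)
qed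

text \<open>The difference quotient is taken within the interval so that the end points are covered;
  c < e ensures that no point of it is isolated.\<close>

lemma derivative_le_Lipschitz:
  fixes f :: "real \<Rightarrow> real"
  assumes der: "(f has_real_derivative d) (at x)" and "c < e" "x \<in> {c..e}"
    and lip: "\<And>y. y \<in> {c..e} \<Longrightarrow> \<bar>f y - f x\<bar> \<le> B * \<bar>y - x\<bar>"
  shows "\<bar>d\<bar> \<le> B"
proof -
  have "((\<lambda>y. \<bar>(f y - f x) / (y - x)\<bar>) \<longlongrightarrow> \<bar>d\<bar>) (at x within {c..e})"
    using has_field_derivative_at_within[OF der] unfolding has_field_derivative_iff by (rule tendsto_rabs)
  moreover have "\<forall>\<^sub>F y in at x within {c..e}. \<bar>(f y - f x) / (y - x)\<bar> \<le> B"
    unfolding eventually_at_filter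
    by (rule always_eventually) (use lip in \<open>auto simp: abs_divide divide_le_eq\<close>)
  moreover have "at x within {c..e} \<noteq> bot"
    using assms(2,3) by (simp add: trivial_limit_within islimpt_Icc)
  ultimately show ?thesis by (intro tendsto_upperbound)
qed

text \<open>The bound on the second partial derivative comes from a Lipschitz estimate instead of the
  symmetry of second derivatives.\<close>

lemma bounds_from_mixed_derivative:
  fixes E :: "real \<times> real \<Rightarrow> real"
  assumes E: "smooth_fun E" and ab: "a < b" and cd: "c < d"
    and Ea: "\<And>y. E (a, y) = 0" and Ec: "\<And>x. E (x, c) = 0"
    and mixed: "\<And>x y. x \<in> {a..b} \<Longrightarrow> y \<in> {c..d} \<Longrightarrow> \<bar>dir_deriv (0, 1) (dir_deriv (1, 0) E) (x, y)\<bar> \<le> e"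
    and x: "x \<in> {a..b}" and y: "y \<in> {c..d}"
  shows "\<bar>dir_deriv (1, 0) E (x, y)\<bar> \<le> e * (d - c)" "\<bar>dir_deriv (0, 1) E (x, y)\<bar> \<le> e * (b - a)"
    "\<bar>E (x, y)\<bar> \<le> e * (b - a) * (d - c)"
proof -
  have e: "e \<ge> 0" using mixed[OF x y] by linarith
  have B: "(1, 0) \<in> (Basis :: (real \<times> real) set)" by (simp add: Basis_real_prod)
  note dE = smooth_fun_dir_deriv[OF E B]
  have lip: "\<bar>dir_deriv (1, 0) E (x, y2) - dir_deriv (1, 0) E (x, y1)\<bar> \<le> e * \<bar>y2 - y1\<bar>"
    if "x \<in> {a..b}" "y1 \<in> {c..d}" "y2 \<in> {c..d}" for x y1 y2
    using field_differentiable_bound[of "{c..d}" "\<lambda>t. dir_deriv (1, 0) E (x, t)"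
        "\<lambda>t. dir_deriv (0, 1) (dir_deriv (1, 0) E) (x, t)" e y2 y1]
      has_field_derivative_at_within[OF has_real_derivative_slice(2)[OF dE]] mixed[OF that(1)] that(2,3) by simp
  \<comment> \<open>Differentiate along the line y = c, on which \<open>E\<close> is constantly
    zero.\<close>
  have Ec': "dir_deriv (1, 0) E (x, c) = 0" for x
    using has_real_derivative_slice(1)[OF E, of c x] DERIV_unique[OF _ DERIV_const[of 0]] by (simp add: Ec)
  show dx: "\<bar>dir_deriv (1, 0) E (x, y)\<bar> \<le> e * (d - c)"
  proof -
    have "\<bar>dir_deriv (1, 0) E (x, y)\<bar> \<le> e * \<bar>y - c\<bar>" using lip[OF x, of c y] y by (simp add: Ec')
    also have "\<dots> \<le> e * (d - c)" using e y by (intro mult_left_mono) auto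
    finally show ?thesis .
  qed
  have Elip: "\<bar>E (x, y2) - E (x, y1)\<bar> \<le> e * (b - a) * \<bar>y2 - y1\<bar>"
    if "y1 \<in> {c..d}" "y2 \<in> {c..d}" for y1 y2
  proof -
    \<comment> \<open>Mean value estimate in the first variable, started at \<open>a\<close>, where
      the increment in y vanishes; its derivative was bounded by \<open>lip\<close>.\<close>
    have "norm ((E (x, y2) - E (x, y1)) - (E (a, y2) - E (a, y1))) \<le> (e * \<bar>y2 - y1\<bar>) * norm (x - a)"
    proof (rule field_differentiable_bound[of "{a..b}" "\<lambda>t. E (t, y2) - E (t, y1)"
        "\<lambda>t. dir_deriv (1, 0) E (t, y2) - dir_deriv (1, 0) E (t, y1)" "e * \<bar>y2 - y1\<bar>" x a])
      show "((\<lambda>t. E (t, y2) - E (t, y1)) has_real_derivative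
          dir_deriv (1, 0) E (t, y2) - dir_deriv (1, 0) E (t, y1)) (at t within {a..b})" for t
        by (rule has_field_derivative_at_within[OF DERIV_diff[OF has_real_derivative_slice(1)[OF E]
            has_real_derivative_slice(1)[OF E]]])
      show "norm (dir_deriv (1, 0) E (t, y2) - dir_deriv (1, 0) E (t, y1)) \<le> e * \<bar>y2 - y1\<bar>"
        if "t \<in> {a..b}" for t
        unfolding real_norm_def by (rule lip) fact+
    qed (use x ab in simp_all)
    also have "\<dots> \<le> (e * \<bar>y2 - y1\<bar>) * (b - a)" using x e by (intro mult_left_mono) auto
    finally show ?thesis by (simp add: Ea mult_ac)
  qed
  show "\<bar>dir_deriv (0, 1) E (x, y)\<bar> \<le> e * (b - a)"
    by (rule derivative_le_Lipschitz[OF has_real_derivative_slice(2)[OF E] cd y Elip[OF y]])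
  have "\<bar>E (x, y)\<bar> \<le> e * (b - a) * \<bar>y - c\<bar>" using Elip[of c y] y by (simp add: Ec)
  also have "\<dots> \<le> e * (b - a) * (d - c)" using e y ab by (intro mult_left_mono) auto
  finally show "\<bar>E (x, y)\<bar> \<le> e * (b - a) * (d - c)" .
qed

lemma smooth_fun_diff:
  assumes "smooth_fun f" "smooth_fun g"
  shows "smooth_fun (\<lambda>x. f x - g x)"
  using smooth_fun_add[OF assms(1) smooth_fun_cmult[OF assms(2), of "-1"]] by simp

lemma dir_deriv_diff:
  assumes "smooth_fun f" "smooth_fun g"
  shows "dir_deriv i (\<lambda>x. f x - g x) = (\<lambda>x. dir_deriv i f x - dir_deriv i g x)"
  by (rule ext, rule dir_derivI) (intro has_derivative_diff smooth_fun_has_derivative assms)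

lemma tensor_span_mono:
  assumes "tensor_span V W h" "V \<subseteq> V'" "W \<subseteq> W'"
  shows "tensor_span V' W' h"
  using assms(1) by induction (use assms(2,3) in \<open>auto intro: tensor_span.intros\<close>)

lemma test_fun_zero: "test_fun U (\<lambda>_. 0)"
  by (rule test_funI[OF smooth_fun_const, of "{}"]) auto

lemma test_fun_tensor_span:
  assumes "tensor_span {p. test_fun A p} {q. test_fun B q} S"
  shows "test_fun (A \<times> B) S"
  using assms by induction (auto intro: test_fun_add test_fun_tensor test_fun_zero)

lemma test_fun_cutoff_mult:
  fixes U :: "real set"
  assumes "smooth_fun \<eta>" "\<And>x. x \<notin> {a..b} \<Longrightarrow> \<eta> x = 0" "{a..b} \<subseteq> U" "smooth_fun p"
  shows "test_fun U (\<lambda>x. \<eta> x * p x)"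
  by (rule test_funI[of _ "{a..b}"]) (use assms in \<open>auto intro: smooth_fun_mult\<close>)

lemma smooth_compact_support_bounded:
  assumes "smooth_fun h" "compact K" "\<And>x. x \<notin> K \<Longrightarrow> h x = 0"
  obtains C where "C > 0" "\<And>x. \<bar>h x\<bar> \<le> C"
proof -
  have "bounded (h ` K)"
    by (intro compact_imp_bounded compact_continuous_image smooth_fun_continuous assms)
  then obtain C where C: "C > 0" "\<forall>y\<in>h ` K. norm y \<le> C" by (auto simp: bounded_pos)
  have "\<bar>h x\<bar> \<le> C" for x
    using C assms(3)[of x] by (cases "x \<in> K") auto
  then show ?thesis using that C by blast
qed

lemma norm_real_Pair_le: "norm ((x, y) :: real \<times> real) \<le> \<bar>x\<bar> + \<bar>y\<bar>"
  by (simp add: norm_Pair sqrt_sum_squares_le_sum_abs)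

text \<open>Approximate the mixed derivative of \<open>\<phi>\<close> by a polynomial, integrate it twice and
  multiply the result by a cutoff which is 1 on the support of \<open>\<phi>\<close>.\<close>

lemma test_fun_approx_tensor_span:
  fixes A B :: "real set"
  assumes A: "open A" "connected A" "A \<noteq> {}" and B: "open B" "connected B" "B \<noteq> {}"
    and \<phi>: "test_fun (A \<times> B) \<phi>" and \<epsilon>: "\<epsilon> > 0"
  shows "\<exists>S. tensor_span {p. test_fun A p} {q. test_fun B q} S \<and> (\<forall>z. norm (cgrad (\<lambda>z. S z - \<phi> z) z) \<le> \<epsilon>)"
proof -
  obtain K where K: "smooth_fun \<phi>" "compact K" "K \<subseteq> A \<times> B" "\<And>z. z \<notin> K \<Longrightarrow> \<phi> z = 0"
    using \<phi> by (rule test_funE) blast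
  have K1: "compact (fst ` K)" "fst ` K \<subseteq> A" and K2: "compact (snd ` K)" "snd ` K \<subseteq> B"
    using K(2,3) by (auto intro!: compact_continuous_image continuous_intros)
  obtain \<alpha> \<beta> \<delta> where x: "\<alpha> \<le> \<beta>" "\<delta> > 0" "fst ` K \<subseteq> {\<alpha>..\<beta>}" "{\<alpha> - \<delta>..\<beta> + \<delta>} \<subseteq> A"
    using compact_subset_open_interval[OF A K1] by blast
  obtain \<gamma> \<theta> \<kappa> where y: "\<gamma> \<le> \<theta>" "\<kappa> > 0" "snd ` K \<subseteq> {\<gamma>..\<theta>}" "{\<gamma> - \<kappa>..\<theta> + \<kappa>} \<subseteq> B"
    using compact_subset_open_interval[OF B K2] by blast
  obtain \<eta> where \<eta>: "smooth_fun \<eta>" "\<And>x. x \<in> {\<alpha>..\<beta>} \<Longrightarrow> \<eta> x = 1" "\<And>x. x \<notin> {\<alpha> - \<delta>..\<beta> + \<delta>} \<Longrightarrow> \<eta> x = 0"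
    using smooth_cutoff_exists[OF x(2)] by blast
  obtain \<zeta> where \<zeta>: "smooth_fun \<zeta>" "\<And>y. y \<in> {\<gamma>..\<theta>} \<Longrightarrow> \<zeta> y = 1" "\<And>y. y \<notin> {\<gamma> - \<kappa>..\<theta> + \<kappa>} \<Longrightarrow> \<zeta> y = 0"
    using smooth_cutoff_exists[OF y(2)] by blast
  define a b c d where "a = \<alpha> - \<delta>" and "b = \<beta> + \<delta>" and "c = \<gamma> - \<kappa>" and "d = \<theta> + \<kappa>"
  note abcd = a_def b_def c_def d_def
  have ab: "a < b" and cd: "c < d" using x y by (auto simp: abcd)
  define Q where "Q = {a..b} \<times> {c..d}"
  have Q: "compact Q" unfolding Q_def by (intro compact_Times compact_Icc)
  let ?W = "tensor \<eta> \<zeta>"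
  have W: "smooth_fun ?W" by (rule smooth_fun_tensor[OF \<eta>(1) \<zeta>(1)])
  have W0: "?W z = 0" if "z \<notin> Q" for z
    using that \<eta>(3)[of "fst z"] \<zeta>(3)[of "snd z"] by (cases z) (auto simp: Q_def tensor_def abcd)
  have dW0: "dir_deriv i ?W z = 0" if "z \<notin> Q" for i z
    by (rule dir_deriv_zero_outside[OF Q W0 that])
  have Bx: "(1, 0) \<in> (Basis :: (real \<times> real) set)" and By: "(0, 1) \<in> (Basis :: (real \<times> real) set)"
    by (auto simp: Basis_real_prod)
  obtain C0 where C0: "C0 > 0" "\<And>z. \<bar>?W z\<bar> \<le> C0"
    using smooth_compact_support_bounded[OF W Q W0] by blast
  obtain C1 where C1: "C1 > 0" "\<And>z. \<bar>dir_deriv (1, 0) ?W z\<bar> \<le> C1"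
    using smooth_compact_support_bounded[OF smooth_fun_dir_deriv[OF W Bx] Q dW0] by blast
  obtain C2 where C2: "C2 > 0" "\<And>z. \<bar>dir_deriv (0, 1) ?W z\<bar> \<le> C2"
    using smooth_compact_support_bounded[OF smooth_fun_dir_deriv[OF W By] Q dW0] by blast
  define C where "C = C0 + C1 + C2"
  have C: "C > 0" "\<bar>?W z\<bar> \<le> C" "\<bar>dir_deriv (1, 0) ?W z\<bar> \<le> C" "\<bar>dir_deriv (0, 1) ?W z\<bar> \<le> C" for z
    using C0(1) C1(1) C2(1) C0(2)[of z] C1(2)[of z] C2(2)[of z] unfolding C_def by linarith+
  \<comment> \<open>\<open>M\<close> adds up the four terms of the product rule, two in each
    component of the gradient of cutoff times error; \<open>C\<close> bounds the cutoff and its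
    partial derivatives.\<close>
  define M where "M = 2 * (b - a) * (d - c) + (d - c) + (b - a)"
  have M: "M > 0" using ab cd unfolding M_def by (intro add_pos_pos mult_pos_pos) auto
  define e where "e = \<epsilon> / (C * M)"
  have e: "e > 0" using \<epsilon> C M by (simp add: e_def)
  let ?m = "dir_deriv (0, 1) (dir_deriv (1, 0) \<phi>)"
  have d\<phi>: "smooth_fun (dir_deriv (1, 0) \<phi>)" by (rule smooth_fun_dir_deriv[OF K(1) Bx])
  have "continuous_on Q ?m" by (rule smooth_fun_continuous[OF smooth_fun_dir_deriv[OF d\<phi> By]])
  then obtain P where P: "real_polynomial_function P" "\<And>z. z \<in> Q \<Longrightarrow> \<bar>?m z - P z\<bar> < e"
    using Stone_Weierstrass_real_polynomial_function[OF Q _ e] by blast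
  obtain S where S: "tensor_span {p. smooth_fun p} {p. smooth_fun p} S" "smooth_fun S" "\<And>y. S (a, y) = 0"
     "\<And>x. S (x, c) = 0" "dir_deriv (0, 1) (dir_deriv (1, 0) S) = P"
    using tensor_span_smooth_antiderivative[OF real_polynomial_function_tensor_span[OF P(1)]] by blast
  let ?E = "\<lambda>z. S z - \<phi> z"
  have E: "smooth_fun ?E" by (rule smooth_fun_diff[OF S(2) K(1)])
  \<comment> \<open>The box is strictly larger than the intervals around the projections of
    \<open>K\<close>, so \<phi> vanishes on the same two lines as \<open>S\<close>.\<close>
  have "(a, y) \<notin> K" for y using x(2,3) by (force simp: a_def)
  then have Ea: "?E (a, y) = 0" for y by (simp add: S(3) K(4))
  have "(x, c) \<notin> K" for x using y(2,3) by (force simp: c_def)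
  then have Ec: "?E (x, c) = 0" for x by (simp add: S(4) K(4))
  have dE: "dir_deriv (0, 1) (dir_deriv (1, 0) ?E) = (\<lambda>z. P z - ?m z)"
    unfolding dir_deriv_diff[OF S(2) K(1)] dir_deriv_diff[OF smooth_fun_dir_deriv[OF S(2) Bx] d\<phi>]
    by (simp add: S(5)[THEN fun_cong])
  have mixed: "\<bar>dir_deriv (0, 1) (dir_deriv (1, 0) ?E) (x, y)\<bar> \<le> e" if "x \<in> {a..b}" "y \<in> {c..d}" for x y
    using P(2)[of "(x, y)"] that unfolding dE[THEN fun_cong] by (auto simp: Q_def abs_minus_commute)
  have bounds: "\<bar>dir_deriv (1, 0) ?E z\<bar> \<le> e * (d - c)" "\<bar>dir_deriv (0, 1) ?E z\<bar> \<le> e * (b - a)"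
    "\<bar>?E z\<bar> \<le> e * (b - a) * (d - c)" if z: "z \<in> Q" for z
  proof -
    obtain x y where xy: "z = (x, y)" "x \<in> {a..b}" "y \<in> {c..d}" using z by (auto simp: Q_def)
    note bd = bounds_from_mixed_derivative[OF E ab cd Ea Ec mixed xy(2,3)]
    show "\<bar>dir_deriv (1, 0) ?E z\<bar> \<le> e * (d - c)" unfolding xy(1) by (rule bd(1))
    show "\<bar>dir_deriv (0, 1) ?E z\<bar> \<le> e * (b - a)" unfolding xy(1) by (rule bd(2))
    show "\<bar>?E z\<bar> \<le> e * (b - a) * (d - c)" unfolding xy(1) by (rule bd(3))
  qed
  let ?S = "\<lambda>z. ?W z * S z"
  have W\<phi>: "?W z * \<phi> z = \<phi> z" for z
  proof (cases "z \<in> K")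
    case True
    then have "fst z \<in> {\<alpha>..\<beta>}" "snd z \<in> {\<gamma>..\<theta>}" using x(3) y(3) by blast+
    then have "?W z = 1" using \<eta>(2) \<zeta>(2) by (simp add: tensor_def case_prod_beta)
    then show ?thesis by simp
  qed (simp add: K(4))
  \<comment> \<open>Since the cutoff leaves \<phi> unchanged, the new error is the cutoff times the
    old one; bounds on the error are thus required only in the box.\<close>
  have eq: "(\<lambda>z. ?S z - \<phi> z) = (\<lambda>z. ?W z * ?E z)"
    by (simp add: right_diff_distrib W\<phi>)
  have dWE: "dir_deriv i (\<lambda>z. ?W z * ?E z) z = ?W z * dir_deriv i ?E z + dir_deriv i ?W z * ?E z" for i z
    by (rule dir_derivI) (intro has_derivative_mult smooth_fun_has_derivative W E)
  have "norm (cgrad (\<lambda>z. ?S z - \<phi> z) z) \<le> \<epsilon>" for z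
  proof (cases "z \<in> Q")
    case True
    note b = bounds[OF True]
    have nn: "0 \<le> C" using C(1) by simp
    have "norm (cgrad (\<lambda>z. ?S z - \<phi> z) z)
      \<le> \<bar>?W z * dir_deriv (1, 0) ?E z + dir_deriv (1, 0) ?W z * ?E z\<bar>
        + \<bar>?W z * dir_deriv (0, 1) ?E z + dir_deriv (0, 1) ?W z * ?E z\<bar>"
      unfolding eq cgrad_prod dWE by (rule norm_real_Pair_le)
    also have "\<dots> \<le> (C * (e * (d - c)) + C * (e * (b - a) * (d - c)))
        + (C * (e * (b - a)) + C * (e * (b - a) * (d - c)))"
      using b C(2,3,4)[of z] nn
      by (intro add_mono order_trans[OF abs_triangle_ineq]) (auto simp: abs_mult intro!: mult_mono)
    also have "\<dots> = C * M * e" unfolding M_def by (simp add: algebra_simps)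
    also have "\<dots> = \<epsilon>" using C(1) M by (simp add: e_def)
    finally show ?thesis .
  next
    case False
    then show ?thesis unfolding eq cgrad_prod dWE using \<epsilon> by (simp add: W0 dW0)
  qed
  moreover have "tensor_span {p. test_fun A p} {q. test_fun B q} ?S"
    using S(1)
  proof (rule tensor_span_tensor_mult)
    show "(\<lambda>x. \<eta> x * p x) \<in> {p. test_fun A p}" if "p \<in> {p. smooth_fun p}" for p
      using that test_fun_cutoff_mult[OF \<eta>(1,3) x(4)] by simp
    show "(\<lambda>y. \<zeta> y * q y) \<in> {q. test_fun B q}" if "q \<in> {p. smooth_fun p}" for q
      using that test_fun_cutoff_mult[OF \<zeta>(1,3) y(4)] by simp
  qed
  ultimately show ?thesis by blast
qed

lemma H10_tensor_span:
  assumes "open A" "open B" "tensor_span (H10 A) (H10 B) S"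
  shows "S \<in> H10 (A \<times> B)"
  using assms(3)
  by induction (auto intro: H10_zero H10_add H10_tensor open_Times assms)

lemma dirichlet_add_self_le:
  assumes "open U" "u \<in> H10 U" "v \<in> H10 U"
  shows "dirichlet U (\<lambda>x. u x + v x) (\<lambda>x. u x + v x) \<le> 2 * dirichlet U u u + 2 * dirichlet U v v"
proof -
  have D: "dirichlet U (\<lambda>x. u x + c * v x) (\<lambda>x. u x + c * v x)
    = dirichlet U u u + 2 * c * dirichlet U u v + c\<^sup>2 * dirichlet U v v" for c
  proof -
    note cv = H10_cmult[OF assms(3), of c]
    note uv = H10_add[OF assms(1,2) cv]
    show ?thesis
      by (simp add: dirichlet_add_left[OF assms(1,2) cv uv] dirichlet_cmult_left[OF assms(1,3) uv]
          dirichlet_commute[of U _ "\<lambda>x. u x + c * v x"] dirichlet_add_left[OF assms(1,2) cv assms(2)]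
          dirichlet_add_left[OF assms(1,2) cv assms(3)] dirichlet_cmult_left[OF assms(1,3,2)]
          dirichlet_cmult_left[OF assms(1,3,3)] dirichlet_commute[of U v u] algebra_simps power2_eq_square)
  qed
  show ?thesis
    using D[of 1] D[of "-1"] dirichlet_self_nonneg[of U "\<lambda>x. u x + (-1) * v x"] by simp
qed

text \<open>Pass through a test function: it is near u by the definition of H^1_0, and its gradient
  is uniformly near that of a tensor sum. Boundedness of the domain turns uniform into L2
  closeness.\<close>

lemma H10_tensor_dense:
  fixes A B :: "real set"
  assumes A: "bounded_domain A" and B: "bounded_domain B" and u: "u \<in> H10 (A \<times> B)" and \<epsilon>: "\<epsilon> > 0"
  obtains S where "tensor_span (H10 A) (H10 B) S" "dirichlet (A \<times> B) (\<lambda>z. u z - S z) (\<lambda>z. u z - S z) \<le> \<epsilon>"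
proof -
  let ?U = "A \<times> B"
  let ?M = "lebesgue_on ?U"
  have o: "open A" "open B" using A B by (auto simp: bounded_domain_def)
  then have U: "open ?U" by (intro open_Times)
  have "bounded ?U" using A B by (intro bounded_Times) (auto simp: bounded_domain_def)
  then have lm: "?U \<in> lmeasurable" using U by (intro lmeasurable_open)
  interpret M: finite_measure ?M using lm by (rule finite_measure_lebesgue_on)
  let ?m = "measure ?M (space ?M)"
  obtain G where G: "is_H10_grad ?U u G" using u by (auto simp: H10_def)
  then obtain \<phi> where \<phi>: "\<And>k. test_fun ?U (\<phi> k)" "(\<lambda>k. \<integral>x. (norm (cgrad (\<phi> k) x - G x))\<^sup>2 \<partial>?M) \<longlonglongrightarrow> 0"
    unfolding is_H10_grad_iff by blast
  have "\<forall>\<^sub>F k in sequentially. (\<integral>x. (norm (cgrad (\<phi> k) x - G x))\<^sup>2 \<partial>?M) < \<epsilon> / 4"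
    using \<phi>(2) \<epsilon> by (intro order_tendstoD) auto
  then obtain k where k: "(\<integral>x. (norm (cgrad (\<phi> k) x - G x))\<^sup>2 \<partial>?M) < \<epsilon> / 4"
    by (auto simp: eventually_sequentially)
  \<comment> \<open>Chosen so that (m + 1) e^2 = \<epsilon> / 4, where the 1 keeps the denominator
    positive. Both errors have energy at most \<epsilon> / 4, and the energy of their sum is at most
    twice the sum of energies.\<close>
  define e where "e = sqrt (\<epsilon> / (4 * (?m + 1)))"
  have m1: "?m + 1 > 0" by (smt (verit) measure_nonneg)
  have e: "e > 0" "e\<^sup>2 = \<epsilon> / (4 * (?m + 1))" using \<epsilon> m1 by (simp_all add: e_def)
  obtain S where S: "tensor_span {p. test_fun A p} {q. test_fun B q} S" "\<And>z. norm (cgrad (\<lambda>z. S z - \<phi> k z) z) \<le> e"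
    using test_fun_approx_tensor_span[OF _ _ _ _ _ _ \<phi>(1) e(1), of k] A B by (auto simp: bounded_domain_def)
  have S': "tensor_span (H10 A) (H10 B) S"
    by (rule tensor_span_mono[OF S(1)]) (auto intro: H10_gradI is_H10_grad_test_fun o)
  let ?v = "\<lambda>z. \<phi> k z + (-1) * u z" and ?w = "\<lambda>z. S z + (-1) * \<phi> k z"
  have v: "is_H10_grad ?U ?v (\<lambda>z. cgrad (\<phi> k) z + (-1) *\<^sub>R G z)"
    by (intro is_H10_grad_add is_H10_grad_cmult is_H10_grad_test_fun U \<phi> G)
  have tw: "test_fun ?U ?w"
    by (intro test_fun_add test_fun_cmult \<phi> test_fun_tensor_span S)
  note w = is_H10_grad_test_fun[OF U tw]
  have "dirichlet ?U ?v ?v = (\<integral>z. (norm (cgrad (\<phi> k) z - G z))\<^sup>2 \<partial>?M)"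
    unfolding dirichlet_eq[OF U v v] power2_norm_eq_inner by simp
  then have dv: "dirichlet ?U ?v ?v \<le> \<epsilon> / 4" using k by linarith
  have "dirichlet ?U ?w ?w = (\<integral>z. (norm (cgrad ?w z))\<^sup>2 \<partial>?M)"
    by (simp only: dirichlet_eq[OF U w w] power2_norm_eq_inner)
  also have "\<dots> \<le> (\<integral>z. e\<^sup>2 \<partial>?M)"
    using S(2) e(1) test_fun_sq_integrable(2)[OF U tw]
    by (intro integral_mono) (auto intro!: power_mono simp: sq_integrable_def)
  also have "\<dots> = ?m * e\<^sup>2" by simp
  also have "\<dots> \<le> (?m + 1) * e\<^sup>2" by (intro mult_right_mono) auto
  also have "\<dots> = \<epsilon> / 4" using m1 by (simp add: e(2) field_simps)
  finally have dw: "dirichlet ?U ?w ?w \<le> \<epsilon> / 4" .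
  have vH: "?v \<in> H10 ?U" and wH: "?w \<in> H10 ?U" using v w by (auto intro: H10_gradI)
  have SuH: "(\<lambda>z. S z - u z) \<in> H10 ?U" by (intro H10_diff U u H10_tensor_span o S')
  have "(\<lambda>z. ?v z + ?w z) = (\<lambda>z. S z - u z)" by auto
  then have le: "dirichlet ?U (\<lambda>z. S z - u z) (\<lambda>z. S z - u z) \<le> \<epsilon>"
    using dirichlet_add_self_le[OF U vH wH] dv dw by simp
  have "(\<lambda>z. u z - S z) = (\<lambda>z. (-1) * (S z - u z))" by auto
  then have "dirichlet ?U (\<lambda>z. u z - S z) (\<lambda>z. u z - S z) = dirichlet ?U (\<lambda>z. S z - u z) (\<lambda>z. S z - u z)"
    by (simp only: dirichlet_cmult_left[OF U SuH H10_cmult[OF SuH]]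
        dirichlet_commute[of ?U "\<lambda>z. S z - u z" "\<lambda>z. (-1) * (S z - u z)"] dirichlet_cmult_left[OF U SuH SuH])
  then show ?thesis using that[OF S'] le by simp
qed

subsection \<open>The greedy algorithm\<close>

text \<open>By Cauchy-Schwarz the square of the m-th partial sum is at most m A, with A the sum of
  all squares. If the product stayed above \<epsilon>, the m-th square would be at least
  \<epsilon>^2 / (A m), against divergence of the harmonic series.\<close>

lemma square_summable_liminf:
  fixes a :: "nat \<Rightarrow> real"
  assumes nonneg: "\<And>n. a n \<ge> 0" and sm: "summable (\<lambda>n. (a n)\<^sup>2)" and \<epsilon>: "\<epsilon> > 0"
  obtains m where "m \<ge> N" "a m * (\<Sum>k<m. a k) < \<epsilon>"
proof -
  define A where "A = (\<Sum>n. (a n)\<^sup>2)"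
  have S2: "(\<Sum>k<m. a k)\<^sup>2 \<le> real m * A" for m
  proof -
    have "(\<Sum>k<m. a k)\<^sup>2 \<le> real m * (\<Sum>k<m. (a k)\<^sup>2)"
      using sum_squared_le_sum_of_squares[of a "{..<m}"] by (simp add: mult.commute)
    also have "\<dots> \<le> real m * A"
      unfolding A_def using sm by (intro mult_left_mono sum_le_suminf) auto
    finally show ?thesis .
  qed
  have A0: "A \<ge> 0" unfolding A_def using sm by (intro suminf_nonneg) auto
  have "\<exists>m\<ge>N. a m * (\<Sum>k<m. a k) < \<epsilon>"
  proof (rule ccontr)
    assume "\<not> ?thesis"
    then have ge: "\<epsilon> \<le> a m * (\<Sum>k<m. a k)" if "m \<ge> N" for m using that by force
    have key: "\<epsilon>\<^sup>2 \<le> (a m)\<^sup>2 * (real m * A)" if "m \<ge> N" for m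
    proof -
      have "\<epsilon>\<^sup>2 \<le> (a m * (\<Sum>k<m. a k))\<^sup>2" using ge[OF that] \<epsilon> by (intro power_mono) auto
      also have "\<dots> = (a m)\<^sup>2 * (\<Sum>k<m. a k)\<^sup>2" by (simp add: power_mult_distrib)
      also have "\<dots> \<le> (a m)\<^sup>2 * (real m * A)" by (intro mult_left_mono S2) auto
      finally show ?thesis .
    qed
    \<comment> \<open>With A = 0 the inequality \<open>key\<close> would force \<epsilon> to
      vanish.\<close>
    have "A \<noteq> 0" using key[of N] \<epsilon> by auto
    then have A: "A > 0" using A0 by simp
    have "summable (\<lambda>m. \<epsilon>\<^sup>2 / A * inverse (real m))"
    proof (rule summable_comparison_test'[OF sm, of "max N 1"])
      fix m assume m: "max N 1 \<le> m"
      then have "\<epsilon>\<^sup>2 \<le> (a m)\<^sup>2 * (real m * A)" by (intro key) simp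
      then show "norm (\<epsilon>\<^sup>2 / A * inverse (real m)) \<le> (a m)\<^sup>2"
        using A m by (simp add: field_simps)
    qed
    then have "summable (\<lambda>m. A / \<epsilon>\<^sup>2 * (\<epsilon>\<^sup>2 / A * inverse (real m)))" by (rule summable_mult)
    then have "summable (\<lambda>m. inverse (real m))" using A \<epsilon> by simp
    then show False using not_summable_harmonic[where ?'a = real] by simp
  qed
  then show ?thesis using that by blast
qed

text \<open>The residuals after the first step lie in H^{-1} only, so \<open>fs n\<close> is a
  functional and the recursion is the weak form of adding a Laplacian. Convergence is measured by
  the Dirichlet energy, whose square root is an equivalent norm on H^1_0 of a bounded domain. The
  series start at 0, hence step n + 1 is paired with \<open>fs n\<close>.\<close>

theorem theorem1:
  fixes Ox Oy :: "real set"
    and f g :: "real \<times> real \<Rightarrow> real"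
    and r s :: "nat \<Rightarrow> real \<Rightarrow> real"
    and fs :: "nat \<Rightarrow> (real \<times> real \<Rightarrow> real) \<Rightarrow> real"
  assumes dom_x: "bounded_domain Ox" and dom_y: "bounded_domain Oy"
    and f_L2: "f \<in> L2 (Ox \<times> Oy)"
    and g_H10: "g \<in> H10 (Ox \<times> Oy)"
    and g_sol: "\<forall>v\<in>H10 (Ox \<times> Oy).
        dirichlet (Ox \<times> Oy) g v = integral\<^sup>L (lebesgue_on (Ox \<times> Oy)) (\<lambda>z. f z * v z)"
    and rs_H10: "\<forall>n\<ge>1. r n \<in> H10 Ox \<and> s n \<in> H10 Oy"
    and fs_0: "\<forall>v\<in>H10 (Ox \<times> Oy).
        fs 0 v = integral\<^sup>L (lebesgue_on (Ox \<times> Oy)) (\<lambda>z. f z * v z)"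
    and fs_rec: "\<forall>n\<ge>1. \<forall>v\<in>H10 (Ox \<times> Oy).
        fs n v = fs (n - 1) v - dirichlet (Ox \<times> Oy) (tensor (r n) (s n)) v"
    and galerkin: "\<forall>n\<ge>1. \<forall>\<rho>\<in>H10 Ox. \<forall>\<sigma>\<in>H10 Oy.
        dirichlet (Ox \<times> Oy) (tensor (r n) (s n)) (\<lambda>z. tensor (r n) \<sigma> z + tensor \<rho> (s n) z)
        = fs (n - 1) (\<lambda>z. tensor (r n) \<sigma> z + tensor \<rho> (s n) z)"
  shows "summable (\<lambda>n. dirichlet (Ox \<times> Oy) (tensor (r (Suc n)) (s (Suc n)))
                                            (tensor (r (Suc n)) (s (Suc n))))
       \<and> summable (\<lambda>n. 1/2 * dirichlet (Ox \<times> Oy) (tensor (r (Suc n)) (s (Suc n)))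
                                            (tensor (r (Suc n)) (s (Suc n)))
                        - fs n (tensor (r (Suc n)) (s (Suc n))))
       \<and> (\<Sum>n. dirichlet (Ox \<times> Oy) (tensor (r (Suc n)) (s (Suc n)))
                                    (tensor (r (Suc n)) (s (Suc n))))
         = - 2 * (\<Sum>n. 1/2 * dirichlet (Ox \<times> Oy) (tensor (r (Suc n)) (s (Suc n)))
                                            (tensor (r (Suc n)) (s (Suc n)))
                        - fs n (tensor (r (Suc n)) (s (Suc n))))
       \<and> ((\<forall>n\<ge>1. \<forall>\<rho>\<in>H10 Ox. \<forall>\<sigma>\<in>H10 Oy.
              1/2 * dirichlet (Ox \<times> Oy) (tensor (r n) (s n)) (tensor (r n) (s n))
                - fs (n - 1) (tensor (r n) (s n))
              \<le> 1/2 * dirichlet (Ox \<times> Oy) (tensor \<rho> \<sigma>) (tensor \<rho> \<sigma>)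
                - fs (n - 1) (tensor \<rho> \<sigma>))
          \<longrightarrow> (\<lambda>n. dirichlet (Ox \<times> Oy)
                      (\<lambda>z. g z - (\<Sum>k=1..n. tensor (r k) (s k) z))
                      (\<lambda>z. g z - (\<Sum>k=1..n. tensor (r k) (s k) z))) \<longlonglongrightarrow> 0)"
proof -
  let ?U = "Ox \<times> Oy"
  let ?D = "dirichlet ?U"
  define t where "t n = tensor (r n) (s n)" for n
  define G where "G n = (\<lambda>z. g z - (\<Sum>k=1..n. t k z))" for n
  define q where "q n = ?D (t (Suc n)) (t (Suc n))" for n
  have o: "open Ox" "open Oy" using dom_x dom_y by (auto simp: bounded_domain_def)
  then have U: "open ?U" by (rule open_Times)
  have tH: "t (Suc n) \<in> H10 ?U" for n
    unfolding t_def using rs_H10 by (intro H10_tensor o) auto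
  have tH': "t k \<in> H10 ?U" if "k \<in> {1..n}" for k n
    using tH[of "k - 1"] that by simp
  have GH: "G n \<in> H10 ?U" for n
    unfolding G_def by (intro H10_diff H10_sum U g_H10 tH')
  have G0: "G 0 = g" by (simp add: G_def)
  have GSuc: "G (Suc n) = (\<lambda>z. G n z - t (Suc n) z)" for n
    by (auto simp: G_def)
  have D_diff_right: "?D w (\<lambda>z. u z - v z) = ?D w u - ?D w v"
    if "u \<in> H10 ?U" "v \<in> H10 ?U" "w \<in> H10 ?U" for u v w
    using dirichlet_diff_left[OF U that] by (simp add: dirichlet_commute[of ?U w])
  have D_add_right: "?D w (\<lambda>z. u z + v z) = ?D w u + ?D w v"
    if "u \<in> H10 ?U" "v \<in> H10 ?U" "w \<in> H10 ?U" for u v w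
    using dirichlet_add_left[OF U that] by (simp add: dirichlet_commute[of ?U w])
  have D_cmult_right: "?D w (\<lambda>z. c * u z) = c * ?D w u" if "u \<in> H10 ?U" "w \<in> H10 ?U" for c u w
    using dirichlet_cmult_left[OF U that] by (simp add: dirichlet_commute[of ?U w])
  have fsD: "fs n v = ?D (G n) v" if v: "v \<in> H10 ?U" for n v
  proof (induction n)
    case 0
    then show ?case using fs_0 g_sol v by (simp add: G0)
  next
    case (Suc n)
    have "fs (Suc n) v = fs n v - ?D (t (Suc n)) v" using fs_rec v by (simp add: t_def)
    then show ?case unfolding GSuc by (simp add: Suc dirichlet_diff_left[OF U GH tH v])
  qed
  have Dt: "?D (G n) (t (Suc n)) = q n" for n
  proof -
    \<comment> \<open>With the step's own factors as test pair both summands coincide, so the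
      identity appears doubled.\<close>
    have "?D (t (Suc n)) (\<lambda>z. t (Suc n) z + t (Suc n) z) = fs n (\<lambda>z. t (Suc n) z + t (Suc n) z)"
      using galerkin[rule_format, of "Suc n" "r (Suc n)" "s (Suc n)"] rs_H10 by (simp add: t_def)
    then have "q n + q n = ?D (G n) (t (Suc n)) + ?D (G n) (t (Suc n))"
      unfolding fsD[OF H10_add[OF U tH tH]] D_add_right[OF tH tH tH] D_add_right[OF tH tH GH] q_def .
    then show ?thesis by simp
  qed
  have energy: "?D (G (Suc n)) (G (Suc n)) = ?D (G n) (G n) - q n" for n
  proof -
    have "?D (G (Suc n)) (G (Suc n)) = ?D (G (Suc n)) (G n) - ?D (G (Suc n)) (t (Suc n))"
      by (subst (2) GSuc) (rule D_diff_right[OF GH tH GH])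
    \<comment> \<open>The new residual is orthogonal to the step just subtracted; the energy balance
      is Pythagoras.\<close>
    also have "?D (G (Suc n)) (t (Suc n)) = 0"
      unfolding GSuc dirichlet_diff_left[OF U GH tH tH] by (simp add: Dt q_def)
    also have "?D (G (Suc n)) (G n) = ?D (G n) (G n) - q n"
      unfolding GSuc dirichlet_diff_left[OF U GH tH GH] by (simp add: dirichlet_commute[of ?U "t _"] Dt)
    finally show ?thesis by simp
  qed
  have q0: "q n \<ge> 0" for n unfolding q_def by (rule dirichlet_self_nonneg)
  have psum: "(\<Sum>k<n. q k) = ?D g g - ?D (G n) (G n)" for n
    by (induction n) (simp_all add: G0 energy)
  have sq: "summable q"
  proof (rule summableI_nonneg_bounded[OF q0])
    show "(\<Sum>k<n. q k) \<le> ?D g g" for n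
      unfolding psum using dirichlet_self_nonneg[of ?U "G n"] by simp
  qed
  have En: "1/2 * q n - fs n (t (Suc n)) = - (1/2) * q n" for n
    using Dt fsD[OF tH] by simp
  have part1: "summable (\<lambda>n. 1/2 * q n - fs n (t (Suc n)))"
    "(\<Sum>n. q n) = - 2 * (\<Sum>n. 1/2 * q n - fs n (t (Suc n)))"
    unfolding En using summable_mult[OF sq, of "-(1/2)"] suminf_mult[OF sq, of "-(1/2)"] by auto
  have part2: "(\<lambda>n. ?D (G n) (G n)) \<longlonglongrightarrow> 0"
    if greedy: "\<forall>n\<ge>1. \<forall>\<rho>\<in>H10 Ox. \<forall>\<sigma>\<in>H10 Oy.
       1/2 * ?D (t n) (t n) - fs (n - 1) (t n) \<le> 1/2 * ?D (tensor \<rho> \<sigma>) (tensor \<rho> \<sigma>) - fs (n - 1) (tensor \<rho> \<sigma>)"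
  proof -
    define a where "a n = sqrt (q n)" for n
    have a2: "(a n)\<^sup>2 = q n" and a0: "a n \<ge> 0" for n using q0 by (auto simp: a_def)
    have bound: "\<bar>?D (G n) (tensor \<rho> \<sigma>)\<bar> \<le> a n * sqrt (?D (tensor \<rho> \<sigma>) (tensor \<rho> \<sigma>))"
      if \<rho>: "\<rho> \<in> H10 Ox" and \<sigma>: "\<sigma> \<in> H10 Oy" for n \<rho> \<sigma>
    proof -
      let ?v = "tensor \<rho> \<sigma>"
      have v: "?v \<in> H10 ?U" by (intro H10_tensor o that)
      \<comment> \<open>Compare the minimal energy - q_n / 2 with that of every multiple - c v,
        which is again a tensor product. This gives a quadratic in c that is never negative, and its
        discriminant is the claim.\<close>
      have "(?D (G n) ?v)\<^sup>2 \<le> q n * ?D ?v ?v"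
      proof (rule quadratic_nonneg_discriminant)
        fix c :: real
        have c: "tensor (\<lambda>x. (- c) * \<rho> x) \<sigma> = (\<lambda>z. (- c) * ?v z)" by (auto simp: tensor_def)
        have cv: "(\<lambda>z. (- c) * ?v z) \<in> H10 ?U" by (rule H10_cmult[OF v])
        have "- (1/2) * q n \<le> 1/2 * ?D (\<lambda>z. (- c) * ?v z) (\<lambda>z. (- c) * ?v z) - fs n (\<lambda>z. (- c) * ?v z)"
          using greedy[rule_format, of "Suc n" "\<lambda>x. (- c) * \<rho> x" \<sigma>] H10_cmult[OF \<rho>, of "- c"] \<sigma> En[of n]
          unfolding c by (simp add: q_def)
        also have "\<dots> = 1/2 * (c\<^sup>2 * ?D ?v ?v) + c * ?D (G n) ?v"
          unfolding fsD[OF cv] D_cmult_right[OF v cv] dirichlet_cmult_left[OF U v v] D_cmult_right[OF v GH]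
          by (simp add: power2_eq_square)
        finally show "0 \<le> q n + 2 * c * ?D (G n) ?v + c\<^sup>2 * ?D ?v ?v" by simp
      qed (rule dirichlet_self_nonneg)
      then have "sqrt ((?D (G n) ?v)\<^sup>2) \<le> sqrt (q n * ?D ?v ?v)" by (rule real_sqrt_le_mono)
      then show ?thesis by (simp add: a_def real_sqrt_mult)
    qed
    have a_lim: "a \<longlonglongrightarrow> 0"
      using tendsto_real_sqrt[OF summable_LIMSEQ_zero[OF sq]] by (simp add: a_def[abs_def])
    have span_lim: "(\<lambda>n. ?D (G n) S) \<longlonglongrightarrow> 0" if "tensor_span (H10 Ox) (H10 Oy) S" for S
      using that
    proof induction
      case zero
      have "?D (G n) (\<lambda>_. 0) = 0" for n
        using D_cmult_right[OF GH GH, of n 0 n] by simp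
      then show ?case by simp
    next
      case (add S \<rho> \<sigma>)
      have v: "tensor \<rho> \<sigma> \<in> H10 ?U" by (intro H10_tensor o add)
      have "(\<lambda>n. ?D (G n) (tensor \<rho> \<sigma>)) \<longlonglongrightarrow> 0"
        by (rule Lim_null_comparison[OF _ tendsto_mult_left_zero[OF a_lim]])
          (use bound[OF add(2,3)] in \<open>auto intro!: always_eventually\<close>)
      then show ?case
        using tendsto_add[OF add.IH] by (simp add: D_add_right[OF H10_tensor_span[OF o add(1)] v GH])
    qed
    have mono: "?D (G m) (G m) \<le> ?D (G n) (G n)" if "n \<le> m" for n m
      using that
    proof (induction m rule: dec_induct)
      case (step m)
      then show ?case using energy[of m] q0[of m] by simp
    qed simp
    have D_sum: "?D (G n) (\<lambda>z. \<Sum>k=1..m. t k z) = (\<Sum>k<m. ?D (G n) (t (Suc k)))" for n m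
    proof (induction m)
      case 0
      then show ?case using D_cmult_right[OF GH GH, of n 0 n] by simp
    next
      case (Suc m)
      have "(\<lambda>z. \<Sum>k=1..m. t k z) \<in> H10 ?U" by (intro H10_sum U tH')
      then show ?case using Suc D_add_right[OF _ tH GH] by simp
    qed
    have G_self: "?D (G n) (G n) = ?D (G n) g - (\<Sum>k<n. ?D (G n) (t (Suc k)))" for n
    proof -
      have s: "(\<lambda>z. \<Sum>k=1..n. t k z) \<in> H10 ?U" by (intro H10_sum U tH')
      show ?thesis
        using D_diff_right[OF g_H10 s GH, of n] unfolding D_sum G_def[symmetric] .
    qed
    have small: "\<exists>n. ?D (G n) (G n) < e" if e: "e > 0" for e
    proof -
      \<comment> \<open>Cauchy-Schwarz bounds the square of the pairing with g - S by the energy of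
        G n times \<delta>, and energies never exceed that of g. The 1 covers g of zero energy.
        Three terms below e / 4 then sum to less than e.\<close>
      define \<delta> where "\<delta> = (e / 4)\<^sup>2 / (?D g g + 1)"
      have g1: "?D g g + 1 > 0" using dirichlet_self_nonneg[of ?U g] by simp
      then have "\<delta> > 0" using e by (simp add: \<delta>_def)
      then obtain S where S: "tensor_span (H10 Ox) (H10 Oy) S"
        and dS: "?D (\<lambda>z. g z - S z) (\<lambda>z. g z - S z) \<le> \<delta>"
        by (rule H10_tensor_dense[OF dom_x dom_y g_H10])
      have SH: "S \<in> H10 ?U" by (rule H10_tensor_span[OF o S])
      have gS: "(\<lambda>z. g z - S z) \<in> H10 ?U" by (intro H10_diff U g_H10 SH)
      have 1: "\<bar>?D (G n) (\<lambda>z. g z - S z)\<bar> \<le> e / 4" for n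
      proof -
        have "(?D (G n) (\<lambda>z. g z - S z))\<^sup>2 \<le> ?D (G n) (G n) * ?D (\<lambda>z. g z - S z) (\<lambda>z. g z - S z)"
          by (rule dirichlet_Cauchy_Schwarz[OF GH gS])
        also have "\<dots> \<le> (?D g g + 1) * \<delta>"
          using mono[of 0 n] dS g1 by (intro mult_mono dirichlet_self_nonneg) (auto simp: G0)
        also have "\<dots> = (e / 4)\<^sup>2" using g1 by (simp add: \<delta>_def)
        finally have "\<bar>?D (G n) (\<lambda>z. g z - S z)\<bar> \<le> \<bar>e / 4\<bar>"
          by (simp only: abs_le_square_iff)
        then show ?thesis using e by simp
      qed
      have "\<forall>\<^sub>F n in sequentially. \<bar>?D (G n) S\<bar> < e / 4"
        using tendsto_rabs_zero[OF span_lim[OF S]] e by (intro order_tendstoD) auto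
      then obtain N where N: "\<And>n. n \<ge> N \<Longrightarrow> \<bar>?D (G n) S\<bar> < e / 4"
        by (auto simp: eventually_sequentially)
      \<comment> \<open>The index must lie beyond \<open>N\<close>, so that the pairing with S and
        the sum over earlier steps are small at the same m.\<close>
      obtain m where m: "m \<ge> N" "a m * (\<Sum>k<m. a k) < e / 4"
        using square_summable_liminf[of a "e / 4" N] a0 sq e by (auto simp: a2)
      \<comment> \<open>The earlier steps are themselves tensor products, and the norm of step k + 1
        is \<open>a k\<close>.\<close>
      have "\<bar>\<Sum>k<m. ?D (G m) (t (Suc k))\<bar> \<le> (\<Sum>k<m. a m * a k)"
      proof (rule order_trans[OF sum_abs sum_mono])
        show "\<bar>?D (G m) (t (Suc k))\<bar> \<le> a m * a k" for k
          using bound[of "r (Suc k)" "s (Suc k)" m] rs_H10 by (simp add: a_def q_def t_def)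
      qed
      then have 2: "\<bar>\<Sum>k<m. ?D (G m) (t (Suc k))\<bar> < e / 4"
        using m(2) by (simp add: sum_distrib_left)
      have "?D (G m) g = ?D (G m) (\<lambda>z. g z - S z) + ?D (G m) S"
        using D_diff_right[OF g_H10 SH GH] by simp
      then have "?D (G m) (G m) < e"
        using 1[of m] 2 N[OF m(1)] G_self[of m] e by linarith
      then show ?thesis by blast
    qed
    show ?thesis
    proof (rule LIMSEQ_I)
      fix e :: real assume "e > 0"
      then obtain n where n: "?D (G n) (G n) < e" using small by blast
      have "norm (?D (G m) (G m) - 0) < e" if "m \<ge> n" for m
        using mono[OF that] n dirichlet_self_nonneg[of ?U "G m"] by simp
      then show "\<exists>no. \<forall>m\<ge>no. norm (?D (G m) (G m) - 0) < e" by blast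
    qed
  qed
  show ?thesis
    using sq part1 part2 unfolding G_def q_def t_def by blast
qed

end
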